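(* In the covariate-adaptive randomization setting described in the context, suppose that as $n\to\infty$: (A1) (global balance) $n^{-1}\sum_{i=1}^n(2T_i-1)\overset{p}{\rightarrow}0$; (A2) (covariate balance) $n^{-1/2}\sum_{i=1}^n(2T_i-1)\bm{x}_i\overset{d}{\rightarrow}\bm{\xi}$, where $\bm{\xi}$ is a $(p+q)$-dimensional random vector with $\mathbb{E}[\bm{\xi}]=\bm{0}$. Let $\bm{\xi}_{\mathrm{ex}}$ denote the last $q$ coordinates of $\bm{\xi}$, and let $Z$ be a standard normal random variable independent of $\bm{\xi}_{\mathrm{ex}}$. Then $$\sqrt{n}\left[(\hat{\mu}_1-\hat{\mu}_2)-(\mu_1-\mu_2)\right]\overset{d}{\rightarrow}2\sigma_\epsilon Z+2\bm{\beta}_{\mathrm{ex}}^t\bm{\xi}_{\mathrm{ex}}.$$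
   Context: Setting. Fix integers $p,q\ge 0$. For each $n$ there are $n$ units; $T_i\in\{0,1\}$ is the treatment assignment of unit $i$ ($T_i=1$ for treatment 1, $T_i=0$ for treatment 2), possibly depending on $n$, and $\bm{x}_i=(x_{i,1},\dots,x_{i,p+q})^t$ is its covariate vector. The vectors $\bm{x}_i$ are i.i.d. over $i$; $x_{i,j}$ is distributed as $X_j$, the covariates $X_1,\dots,X_{p+q}$ are independent of each other, with $\mathbb{E}X_j=0$ and $0<\mathrm{Var}(X_j)<\infty$. The outcomes follow the true linear model $$Y_i=\mu_1T_i+\mu_2(1-T_i)+\sum_{j=1}^{p+q}\beta_jx_{i,j}+\epsilon_i,$$ where $\epsilon_1,\dots,\epsilon_n$ are i.i.d. with mean $0$ and variance $\sigma_\epsilon^2\in(0,\infty)$, independent of the covariates. The randomization uses only covariate information (and possibly extra external randomness), not the responses: $(T_1,\dots,T_n)$ and all covariates are jointly independent of $(\epsilon_1,\dots,\epsilon_n)$. Working model. Only the first $p$ covariates are included: $\mathbb{E}[Y_i]=\mu_1T_i+\mu_2(1-T_i)+\sum_{j=1}^p\beta_jx_{i,j}$. Write $\bm{Y}=(Y_1,\dots,Y_n)^t$, $\bm{T}=(T_1,\dots,T_n)^t$, $\mathbf{X}_{\mathrm{in}}=(x_{i,j})_{1\le i\le n,1\le j\le p}$, $\bm{\beta}_{\mathrm{in}}=(\beta_1,\dots,\beta_p)^t$, $\bm{\beta}_{\mathrm{ex}}=(\beta_{p+1},\dots,\beta_{p+q})^t$, $\bm{1}_n$ the vector of $n$ ones,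 $\mathbf{G}=[\bm{T};\bm{1}_n-\bm{T};\mathbf{X}_{\mathrm{in}}]$ (an $n\times(p+2)$ matrix, columns juxtaposed), and $\bm{\theta}=(\mu_1,\mu_2,\bm{\beta}_{\mathrm{in}}^t)^t$. The OLS estimator is $\hat{\bm{\theta}}=(\hat\mu_1,\hat\mu_2,\hat{\bm{\beta}}_{\mathrm{in}}^t)^t=(\mathbf{G}^t\mathbf{G})^{-1}\mathbf{G}^t\bm{Y}$ (defined arbitrarily when $\mathbf{G}^t\mathbf{G}$ is singular). *)

theory Defs
  imports "HOL-Probability.Probability" "Jordan_Normal_Form.Matrix"
begin

no_notation Finite_Cartesian_Product.vec_nth (infixl \<open>$\<close> 90)

text \<open>Units and covariates are numbered from 0: covariates \<open>j < p\<close> are in the working model,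
  covariates \<open>p \<le> j < p + q\<close> are omitted from it. A random vector in \<open>d\<close>-dimensional space is a
  random element of \<open>Pi\<^sub>M J (\<lambda>_. borel)\<close> for an index set \<open>J\<close> of size \<open>d\<close>, so that \<open>d = 0\<close> is
  allowed.\<close>

abbreviation borel_vec :: "'i set \<Rightarrow> ('i \<Rightarrow> real) measure" where
  "borel_vec J \<equiv> Pi\<^sub>M J (\<lambda>_. borel)"

abbreviation rvec :: "'i set \<Rightarrow> ('i \<Rightarrow> 'a \<Rightarrow> real) \<Rightarrow> 'a \<Rightarrow> 'i \<Rightarrow> real" where
  "rvec J U \<equiv> \<lambda>\<omega>. restrict (\<lambda>j. U j \<omega>) J"

text \<open>The predicate \<open>indep_var\<close> forces both random variables to have the same value type;
  here they may differ.\<close>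

definition (in prob_space) indep_rv ::
  "'b measure \<Rightarrow> ('a \<Rightarrow> 'b) \<Rightarrow> 'c measure \<Rightarrow> ('a \<Rightarrow> 'c) \<Rightarrow> bool" where
  "indep_rv S U R V \<longleftrightarrow> random_variable S U \<and> random_variable R V \<and>
     indep_set {U -` A \<inter> space M | A. A \<in> sets S} {V -` B \<inter> space M | B. B \<in> sets R}"

definition tendsto_in_prob :: "'a measure \<Rightarrow> (nat \<Rightarrow> 'a \<Rightarrow> real) \<Rightarrow> real \<Rightarrow> bool" where
  "tendsto_in_prob M U c \<longleftrightarrow>
     (\<forall>e>0. (\<lambda>n. measure M {\<omega> \<in> space M. \<bar>U n \<omega> - c\<bar> > e}) \<longlonglongrightarrow> 0)"

text \<open>Weak convergence of laws on Euclidean space with coordinates in \<open>J\<close> (bounded continuous test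
  functions), the multivariate counterpart of \<open>weak_conv_m\<close>.\<close>

definition weak_conv_vec ::
  "'i set \<Rightarrow> (nat \<Rightarrow> ('i \<Rightarrow> real) measure) \<Rightarrow> ('i \<Rightarrow> real) measure \<Rightarrow> bool" where
  "weak_conv_vec J \<nu> \<nu>' \<longleftrightarrow>
     (\<forall>f. continuous_map (product_topology (\<lambda>_. euclideanreal) J) euclideanreal f \<longrightarrow>
          bounded (f ` (PiE J (\<lambda>_. UNIV))) \<longrightarrow>
          (\<lambda>n. \<integral>z. f z \<partial>\<nu> n) \<longlonglongrightarrow> (\<integral>z. f z \<partial>\<nu>'))"

text \<open>\<open>T n i\<close> is the assignment of unit \<open>i\<close> in the experiment with \<open>n\<close> units, \<open>x i j\<close> the \<open>j\<close>-th
  covariate and \<open>\<epsilon> i\<close> the error of unit \<open>i\<close>.\<close>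

locale car_setting = prob_space M
  for M :: "'a measure"
    and p q :: nat
    and T :: "nat \<Rightarrow> nat \<Rightarrow> 'a \<Rightarrow> real"
    and X :: "nat \<Rightarrow> 'a \<Rightarrow> real"
    and x :: "nat \<Rightarrow> nat \<Rightarrow> 'a \<Rightarrow> real"
    and \<epsilon> :: "nat \<Rightarrow> 'a \<Rightarrow> real"
    and \<sigma> :: real +
  assumes assignment_measurable: "i < n \<Longrightarrow> random_variable borel (T n i)"
    and assignment_01: "i < n \<Longrightarrow> \<omega> \<in> space M \<Longrightarrow> T n i \<omega> \<in> {0, 1}"
    and X_indep: "indep_vars (\<lambda>_. borel) X {..<p+q}"
    and X_integrable: "j < p + q \<Longrightarrow> integrable M (X j)"
    and X_sq_integrable: "j < p + q \<Longrightarrow> integrable M (\<lambda>\<omega>. (X j \<omega>)\<^sup>2)"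
    and X_mean: "j < p + q \<Longrightarrow> expectation (X j) = 0"
    and X_var: "j < p + q \<Longrightarrow> variance (X j) > 0"
    and x_indep: "indep_vars (\<lambda>_. borel_vec {..<p+q}) (\<lambda>i. rvec {..<p+q} (x i)) UNIV"
    and x_law: "distr M (borel_vec {..<p+q}) (rvec {..<p+q} (x i))
                = distr M (borel_vec {..<p+q}) (rvec {..<p+q} X)"
    and \<epsilon>_indep: "indep_vars (\<lambda>_. borel) \<epsilon> UNIV"
    and \<epsilon>_law: "distr M borel (\<epsilon> i) = distr M borel (\<epsilon> 0)"
    and \<epsilon>_integrable: "integrable M (\<epsilon> i)"
    and \<epsilon>_sq_integrable: "integrable M (\<lambda>\<omega>. (\<epsilon> i \<omega>)\<^sup>2)"
    and \<epsilon>_mean: "expectation (\<epsilon> i) = 0"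
    and \<epsilon>_var: "variance (\<epsilon> i) = \<sigma>\<^sup>2"
    and \<sigma>_pos: "\<sigma> > 0"
    and design_indep_errors:
      "indep_rv
         (borel_vec {..<n} \<Otimes>\<^sub>M borel_vec ({..<n} \<times> {..<p+q}))
         (\<lambda>\<omega>. (rvec {..<n} (T n) \<omega>, rvec ({..<n} \<times> {..<p+q}) (\<lambda>(i, j). x i j) \<omega>))
         (borel_vec {..<n}) (rvec {..<n} \<epsilon>)"

definition outcome ::
  "nat \<Rightarrow> real \<Rightarrow> real \<Rightarrow> (nat \<Rightarrow> real) \<Rightarrow> (nat \<Rightarrow> nat \<Rightarrow> 'a \<Rightarrow> real) \<Rightarrow> (nat \<Rightarrow> nat \<Rightarrow> 'a \<Rightarrow> real) \<Rightarrow>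
   (nat \<Rightarrow> 'a \<Rightarrow> real) \<Rightarrow> nat \<Rightarrow> 'a \<Rightarrow> real vec" where
  "outcome d \<mu>\<^sub>1 \<mu>\<^sub>2 \<beta> T x \<epsilon> n \<omega> = vec n (\<lambda>i.
     \<mu>\<^sub>1 * T n i \<omega> + \<mu>\<^sub>2 * (1 - T n i \<omega>) + (\<Sum>j<d. \<beta> j * x i j \<omega>) + \<epsilon> i \<omega>)"

definition design_matrix ::
  "nat \<Rightarrow> (nat \<Rightarrow> nat \<Rightarrow> 'a \<Rightarrow> real) \<Rightarrow> (nat \<Rightarrow> nat \<Rightarrow> 'a \<Rightarrow> real) \<Rightarrow> nat \<Rightarrow> 'a \<Rightarrow> real mat" where
  "design_matrix p T x n \<omega> = mat n (p + 2) (\<lambda>(i, k).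
     if k = 0 then T n i \<omega> else if k = 1 then 1 - T n i \<omega> else x i (k - 2) \<omega>)"

text \<open>\<open>\<theta>\<close> equals \<open>(G\<^sup>t G)\<^sup>-\<^sup>1 G\<^sup>t Y\<close> if \<open>G\<^sup>t G\<close> is invertible, and is an arbitrary vector of the right
  dimension otherwise.\<close>

definition is_ols :: "real mat \<Rightarrow> real vec \<Rightarrow> real vec \<Rightarrow> bool" where
  "is_ols G Y \<theta> \<longleftrightarrow> \<theta> \<in> carrier_vec (dim_col G) \<and>
     (\<forall>B. inverts_mat (transpose_mat G * G) B \<and> inverts_mat B (transpose_mat G * G) \<longrightarrow>
          \<theta> = (B * transpose_mat G) *\<^sub>v Y)"

end

theory Submission
  imports Defs "Jordan_Normal_Form.Determinant"
begin

text \<open>In the regressors \<open>2 * T n i - 1\<close>, \<open>1\<close> and the included covariates, which span the same space as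
  the columns of the design matrix, the Gram matrix divided by \<open>n\<close> has off-diagonal entries tending
  to 0 in probability (by the two balance conditions and by orthogonality of the covariates) and
  diagonal entries bounded away from 0. Diagonal dominance then shows that, up to a term that vanishes
  in probability, the estimation error of \<open>\<mu>\<^sub>1 - \<mu>\<^sub>2\<close> is twice the average of \<open>2 * T n i - 1\<close> times
  the sum of the omitted covariate part and the error of unit \<open>i\<close>. Given the design, the characteristic
  function of the error part is a product of factors at \<open>\<plusminus> s / sqrt n\<close> whose limit does not depend on
  the signs, so it decouples from the covariate part, whose limit is given by the covariate balance
  condition.\<close>

text \<open>The covariates come with second moments only, so their squares need not have a variance,
  and the variance bound that handles all other averages does not apply to the diagonal of the Gram
  matrix. A lower bound is enough there, and it comes from the bounded variable
  \<open>min ((X j \<omega>)\<^sup>2) 1\<close>. Off the diagonal, products of distinct covariates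
  are square-integrable by independence. Assignments may depend on all covariates and on
  \<open>n\<close>, so the summands of the score are dependent across units and a central limit
  theorem for independent summands is not applicable to them. Independence is available for the
  errors alone, once the signs are fixed. Each of the \<open>n\<close> factors may then deviate from
  its limit form by o(1/n) uniformly in the sign, which keeps the total deviation o(1). The factor 2
  comes from the change of regressors: with \<open>w = 2 * T - 1\<close> the treatment columns are
  \<open>(1 + w) / 2\<close> and \<open>(1 - w) / 2\<close>, so the coefficient of \<open>w\<close>
  is half the treatment contrast.\<close>

lemma tendsto_zero_if_eventually_le:
  fixes f :: "nat \<Rightarrow> real"
  assumes "\<And>n. 0 \<le> f n" and "\<And>e. e > 0 \<Longrightarrow> \<forall>\<^sub>F n in sequentially. f n \<le> e"
  shows "f \<longlonglongrightarrow> 0"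
proof (rule tendstoI)
  fix e :: real assume "e > 0"
  then have "\<forall>\<^sub>F n in sequentially. f n \<le> e / 2" by (intro assms(2)) simp
  then show "\<forall>\<^sub>F n in sequentially. dist (f n) 0 < e"
    by eventually_elim (use assms(1) \<open>e > 0\<close> in \<open>auto simp: dist_real_def abs_of_nonneg intro: le_less_trans\<close>)
qed

section \<open>Sequences bounded in probability and sequences vanishing in probability\<close>

context prob_space
begin

text \<open>Measurability is part of this notion and of the next one because \<open>measure\<close>
  is 0 on non-measurable sets, which would satisfy the tail conditions vacuously, and because union
  bounds require events.\<close>

definition bounded_in_prob :: "(nat \<Rightarrow> 'a \<Rightarrow> real) \<Rightarrow> bool" where
  "bounded_in_prob U \<longleftrightarrow> (\<forall>n. U n \<in> borel_measurable M) \<and>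
     (\<forall>e>0. \<exists>K. \<forall>\<^sub>F n in sequentially. prob {\<omega>\<in>space M. \<bar>U n \<omega>\<bar> > K} \<le> e)"

definition null_in_prob :: "(nat \<Rightarrow> 'a \<Rightarrow> real) \<Rightarrow> bool" where
  "null_in_prob U \<longleftrightarrow> (\<forall>n. U n \<in> borel_measurable M) \<and> tendsto_in_prob M U 0"

lemma bounded_in_prob_measurable: "bounded_in_prob U \<Longrightarrow> U n \<in> borel_measurable M"
  and null_in_prob_measurable: "null_in_prob U \<Longrightarrow> U n \<in> borel_measurable M"
  by (auto simp: bounded_in_prob_def null_in_prob_def)

lemma null_in_probD:
  "null_in_prob U \<Longrightarrow> e > 0 \<Longrightarrow> (\<lambda>n. prob {\<omega>\<in>space M. \<bar>U n \<omega>\<bar> > e}) \<longlonglongrightarrow> 0"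
  by (auto simp: null_in_prob_def tendsto_in_prob_def)

lemma prob_le_add:
  assumes "{\<omega>\<in>space M. P \<omega>} \<in> events" "{\<omega>\<in>space M. Q \<omega>} \<in> events"
    and "\<And>\<omega>. \<omega> \<in> space M \<Longrightarrow> R \<omega> \<Longrightarrow> P \<omega> \<or> Q \<omega>"
  shows "prob {\<omega>\<in>space M. R \<omega>} \<le> prob {\<omega>\<in>space M. P \<omega>} + prob {\<omega>\<in>space M. Q \<omega>}"
proof -
  have "prob {\<omega>\<in>space M. R \<omega>} \<le> prob ({\<omega>\<in>space M. P \<omega>} \<union> {\<omega>\<in>space M. Q \<omega>})"
    using assms by (intro finite_measure_mono) auto
  also have "\<dots> \<le> prob {\<omega>\<in>space M. P \<omega>} + prob {\<omega>\<in>space M. Q \<omega>}"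
    using assms by (intro measure_Un_le)
  finally show ?thesis .
qed

lemma bounded_in_prob_add:
  assumes "bounded_in_prob U" "bounded_in_prob V"
  shows "bounded_in_prob (\<lambda>n \<omega>. U n \<omega> + V n \<omega>)"
  unfolding bounded_in_prob_def
proof (intro conjI allI impI)
  note [measurable] = bounded_in_prob_measurable[OF assms(1)] bounded_in_prob_measurable[OF assms(2)]
  show "(\<lambda>\<omega>. U n \<omega> + V n \<omega>) \<in> borel_measurable M" for n by measurable
  fix e :: real assume "e > 0"
  then have "e / 2 > 0" by simp
  then obtain K L where
    K: "\<forall>\<^sub>F n in sequentially. prob {\<omega>\<in>space M. \<bar>U n \<omega>\<bar> > K} \<le> e / 2" and
    L: "\<forall>\<^sub>F n in sequentially. prob {\<omega>\<in>space M. \<bar>V n \<omega>\<bar> > L} \<le> e / 2"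
    using assms unfolding bounded_in_prob_def by meson
  show "\<exists>K. \<forall>\<^sub>F n in sequentially. prob {\<omega>\<in>space M. \<bar>U n \<omega> + V n \<omega>\<bar> > K} \<le> e"
  proof (rule exI[of _ "K + L"], use K L in eventually_elim)
    fix n assume elim: "prob {\<omega>\<in>space M. \<bar>U n \<omega>\<bar> > K} \<le> e / 2" "prob {\<omega>\<in>space M. \<bar>V n \<omega>\<bar> > L} \<le> e / 2"
    have "prob {\<omega>\<in>space M. \<bar>U n \<omega> + V n \<omega>\<bar> > K + L}
        \<le> prob {\<omega>\<in>space M. \<bar>U n \<omega>\<bar> > K} + prob {\<omega>\<in>space M. \<bar>V n \<omega>\<bar> > L}"
      by (rule prob_le_add) auto
    with elim show "prob {\<omega>\<in>space M. \<bar>U n \<omega> + V n \<omega>\<bar> > K + L} \<le> e" by linarith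
  qed
qed

lemma bounded_in_prob_cmult:
  assumes "bounded_in_prob U"
  shows "bounded_in_prob (\<lambda>n \<omega>. c * U n \<omega>)"
  unfolding bounded_in_prob_def
proof (intro conjI allI impI)
  note [measurable] = bounded_in_prob_measurable[OF assms(1)]
  show "(\<lambda>\<omega>. c * U n \<omega>) \<in> borel_measurable M" for n by measurable
  fix e :: real assume "e > 0"
  then obtain K where
    K: "\<forall>\<^sub>F n in sequentially. prob {\<omega>\<in>space M. \<bar>U n \<omega>\<bar> > K} \<le> e"
    using assms unfolding bounded_in_prob_def by meson
  show "\<exists>K. \<forall>\<^sub>F n in sequentially. prob {\<omega>\<in>space M. \<bar>c * U n \<omega>\<bar> > K} \<le> e"
  proof (rule exI[of _ "\<bar>c\<bar> * K"], use K in eventually_elim)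
    fix n assume elim: "prob {\<omega>\<in>space M. \<bar>U n \<omega>\<bar> > K} \<le> e"
    have "prob {\<omega>\<in>space M. \<bar>c * U n \<omega>\<bar> > \<bar>c\<bar> * K} \<le> prob {\<omega>\<in>space M. \<bar>U n \<omega>\<bar> > K}"
    proof (rule finite_measure_mono)
      show "{\<omega>\<in>space M. \<bar>c * U n \<omega>\<bar> > \<bar>c\<bar> * K} \<subseteq> {\<omega>\<in>space M. \<bar>U n \<omega>\<bar> > K}"
        by (auto simp: abs_mult intro: mult_left_less_imp_less)
    qed measurable
    with elim show "prob {\<omega>\<in>space M. \<bar>c * U n \<omega>\<bar> > \<bar>c\<bar> * K} \<le> e" by linarith
  qed
qed

lemma bounded_in_prob_const: "bounded_in_prob (\<lambda>n \<omega>. c)"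
  unfolding bounded_in_prob_def
  by (auto intro!: exI[of _ "\<bar>c\<bar>"])

lemma bounded_in_prob_abs: "bounded_in_prob U \<Longrightarrow> bounded_in_prob (\<lambda>n \<omega>. \<bar>U n \<omega>\<bar>)"
  unfolding bounded_in_prob_def by (simp add: borel_measurable_abs)

lemma bounded_in_prob_sum:
  assumes "finite I" "\<And>i. i \<in> I \<Longrightarrow> bounded_in_prob (U i)"
  shows "bounded_in_prob (\<lambda>n \<omega>. \<Sum>i\<in>I. U i n \<omega>)"
  using assms
  by (induction I rule: finite_induct) (auto intro: bounded_in_prob_add bounded_in_prob_const)

lemma null_times_bounded_in_prob:
  assumes "null_in_prob U" "bounded_in_prob V"
  shows "null_in_prob (\<lambda>n \<omega>. U n \<omega> * V n \<omega>)"
  unfolding null_in_prob_def tendsto_in_prob_def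
proof (intro conjI allI impI)
  note [measurable] = null_in_prob_measurable[OF assms(1)] bounded_in_prob_measurable[OF assms(2)]
  show "(\<lambda>\<omega>. U n \<omega> * V n \<omega>) \<in> borel_measurable M" for n by measurable
  fix e :: real assume "e > 0"
  show "(\<lambda>n. prob {\<omega>\<in>space M. \<bar>U n \<omega> * V n \<omega> - 0\<bar> > e}) \<longlonglongrightarrow> 0"
  proof (rule tendsto_zero_if_eventually_le)
    fix d :: real assume "d > 0"
    then have "d / 2 > 0" by simp
    then obtain K where
      K: "\<forall>\<^sub>F n in sequentially. prob {\<omega>\<in>space M. \<bar>V n \<omega>\<bar> > K} \<le> d / 2"
      using assms unfolding bounded_in_prob_def by meson
    \<comment> \<open>The maximum with 1 makes \<open>L\<close> positive, so that
      \<open>e / L\<close> is an admissible threshold for \<open>U\<close>.\<close>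
    define L where "L = max K 1"
    have L: "L > 0" "K \<le> L" by (auto simp: L_def)
    have "\<forall>\<^sub>F n in sequentially. prob {\<omega>\<in>space M. \<bar>U n \<omega>\<bar> > e / L} < d / 2"
      using null_in_probD[OF assms(1), of "e / L"] \<open>e > 0\<close> \<open>d > 0\<close> L
      by (intro order_tendstoD(2)) auto
    then show "\<forall>\<^sub>F n in sequentially. prob {\<omega>\<in>space M. \<bar>U n \<omega> * V n \<omega> - 0\<bar> > e} \<le> d"
      using K
    proof eventually_elim
      case (elim n)
      have "prob {\<omega>\<in>space M. \<bar>U n \<omega> * V n \<omega> - 0\<bar> > e}
          \<le> prob {\<omega>\<in>space M. \<bar>U n \<omega>\<bar> > e / L} + prob {\<omega>\<in>space M. \<bar>V n \<omega>\<bar> > K}"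
      proof (rule prob_le_add)
        fix \<omega> assume *: "\<bar>U n \<omega> * V n \<omega> - 0\<bar> > e"
        show "\<bar>U n \<omega>\<bar> > e / L \<or> \<bar>V n \<omega>\<bar> > K"
        proof (rule ccontr)
          assume "\<not> ?thesis"
          then have "\<bar>U n \<omega>\<bar> * \<bar>V n \<omega>\<bar> \<le> (e / L) * L"
            using L \<open>e > 0\<close> by (intro mult_mono) auto
          with * L show False by (simp add: abs_mult)
        qed
      qed measurable
      with elim show ?case by linarith
    qed
  qed simp
qed

lemma null_in_prob_add:
  assumes "null_in_prob U" "null_in_prob V"
  shows "null_in_prob (\<lambda>n \<omega>. U n \<omega> + V n \<omega>)"
  unfolding null_in_prob_def tendsto_in_prob_def
proof (intro conjI allI impI)
  note [measurable] = null_in_prob_measurable[OF assms(1)] null_in_prob_measurable[OF assms(2)]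
  show "(\<lambda>\<omega>. U n \<omega> + V n \<omega>) \<in> borel_measurable M" for n by measurable
  fix e :: real assume "e > 0"
  have "(\<lambda>n. prob {\<omega>\<in>space M. \<bar>U n \<omega>\<bar> > e / 2} + prob {\<omega>\<in>space M. \<bar>V n \<omega>\<bar> > e / 2}) \<longlonglongrightarrow> 0"
    using \<open>e > 0\<close> assms by (intro tendsto_add_zero null_in_probD) auto
  then show "(\<lambda>n. prob {\<omega>\<in>space M. \<bar>U n \<omega> + V n \<omega> - 0\<bar> > e}) \<longlonglongrightarrow> 0"
    by (rule tendsto_sandwich[OF always_eventually always_eventually tendsto_const, rotated 2])
       (auto intro!: prob_le_add)
qed

lemma null_in_prob_abs: "null_in_prob U \<Longrightarrow> null_in_prob (\<lambda>n \<omega>. \<bar>U n \<omega>\<bar>)"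
  unfolding null_in_prob_def tendsto_in_prob_def by (simp add: borel_measurable_abs)

lemma null_in_prob_sum:
  assumes "finite I" "\<And>i. i \<in> I \<Longrightarrow> null_in_prob (U i)"
  shows "null_in_prob (\<lambda>n \<omega>. \<Sum>i\<in>I. U i n \<omega>)"
  using assms
proof (induction I rule: finite_induct)
  case empty
  then show ?case by (simp add: null_in_prob_def tendsto_in_prob_def)
qed (auto intro: null_in_prob_add)

lemma bounded_in_prob_divide_sqrt:
  assumes "bounded_in_prob U"
  shows "null_in_prob (\<lambda>n \<omega>. U n \<omega> / sqrt (real n))"
proof -
  have "null_in_prob (\<lambda>n \<omega>. 1 / sqrt (real n))"
    unfolding null_in_prob_def tendsto_in_prob_def
  proof (intro conjI allI impI)
    fix e :: real assume "e > 0"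
    have "(\<lambda>n. 1 / sqrt (real n)) \<longlonglongrightarrow> 0"
      by (intro tendsto_divide_0[OF tendsto_const] filterlim_at_top_imp_at_infinity
          filterlim_compose[OF sqrt_at_top] filterlim_real_sequentially)
    then have "\<forall>\<^sub>F n in sequentially. \<bar>1 / sqrt (real n)\<bar> < e"
      using \<open>e > 0\<close> by (auto dest!: tendstoD[of _ _ _ e] simp: dist_real_def)
    then have "\<forall>\<^sub>F n in sequentially. prob {\<omega> \<in> space M. e < \<bar>1 / sqrt (real n) - 0\<bar>} = 0"
      by eventually_elim auto
    then show "(\<lambda>n. prob {\<omega> \<in> space M. e < \<bar>1 / sqrt (real n) - 0\<bar>}) \<longlonglongrightarrow> 0"
      by (rule tendsto_eventually)
  qed simp
  from null_times_bounded_in_prob[OF this assms] show ?thesis by simp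
qed

text \<open>The tail event of \<open>U\<close> lies in the tail event of \<open>V\<close> together
  with \<open>A n\<close>, so the comparison may fail on events of vanishing probability. In the
  application \<open>A n\<close> contains the outcomes at which the Gram matrix is not safely
  diagonally dominant.\<close>

lemma null_in_prob_dominated:
  assumes U: "\<And>n. U n \<in> borel_measurable M" and V: "null_in_prob V"
    and A: "\<And>n. A n \<in> events" "(\<lambda>n. prob (A n)) \<longlonglongrightarrow> 0"
    and le: "\<And>n \<omega>. n > 0 \<Longrightarrow> \<omega> \<in> space M - A n \<Longrightarrow> \<bar>U n \<omega>\<bar> \<le> \<bar>V n \<omega>\<bar>"
  shows "null_in_prob U"
  unfolding null_in_prob_def tendsto_in_prob_def
proof (intro conjI allI impI U)
  note [measurable] = U null_in_prob_measurable[OF V]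
  fix e :: real assume "e > 0"
  have "\<forall>\<^sub>F n in sequentially. prob {\<omega>\<in>space M. \<bar>U n \<omega> - 0\<bar> > e}
      \<le> prob {\<omega>\<in>space M. \<bar>V n \<omega>\<bar> > e} + prob (A n)"
    using eventually_gt_at_top[of 0]
  proof eventually_elim
    case (elim n)
    have "prob {\<omega>\<in>space M. \<bar>U n \<omega> - 0\<bar> > e} \<le> prob ({\<omega>\<in>space M. \<bar>V n \<omega>\<bar> > e} \<union> A n)"
      using le[OF elim] A(1)[of n] by (intro finite_measure_mono) force+
    also have "\<dots> \<le> prob {\<omega>\<in>space M. \<bar>V n \<omega>\<bar> > e} + prob (A n)"
      using A(1)[of n] by (intro measure_Un_le) auto
    finally show ?case .
  qed
  moreover have "(\<lambda>n. prob {\<omega>\<in>space M. \<bar>V n \<omega>\<bar> > e} + prob (A n)) \<longlonglongrightarrow> 0"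
    using \<open>e > 0\<close> V A by (intro tendsto_add_zero null_in_probD) auto
  ultimately show "(\<lambda>n. prob {\<omega>\<in>space M. \<bar>U n \<omega> - 0\<bar> > e}) \<longlonglongrightarrow> 0"
    by (rule tendsto_sandwich[OF always_eventually _ tendsto_const, rotated]) simp
qed

text \<open>Chebyshev's argument: orthogonality removes the cross terms, so the normalized sum has
  second moment at most \<open>C\<close> for every positive \<open>n\<close>. The summands form a
  triangular array because assignments change with \<open>n\<close>, and orthogonality replaces
  independence because regressors of different units may be dependent.\<close>

lemma bounded_in_prob_orthogonal:
  fixes U :: "nat \<Rightarrow> nat \<Rightarrow> 'a \<Rightarrow> real"
  assumes meas: "\<And>n i. i < n \<Longrightarrow> U n i \<in> borel_measurable M"
    and sq: "\<And>n i. i < n \<Longrightarrow> integrable M (\<lambda>\<omega>. (U n i \<omega>)\<^sup>2)"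
    and bound: "\<And>n i. i < n \<Longrightarrow> expectation (\<lambda>\<omega>. (U n i \<omega>)\<^sup>2) \<le> C"
    and orth: "\<And>n i j. i < n \<Longrightarrow> j < n \<Longrightarrow> i \<noteq> j \<Longrightarrow>
      integrable M (\<lambda>\<omega>. U n i \<omega> * U n j \<omega>) \<and> expectation (\<lambda>\<omega>. U n i \<omega> * U n j \<omega>) = 0"
  shows "bounded_in_prob (\<lambda>n \<omega>. (\<Sum>i<n. U n i \<omega>) / sqrt (real n))"
  unfolding bounded_in_prob_def
proof (intro conjI allI impI)
  show m: "(\<lambda>\<omega>. (\<Sum>i<n. U n i \<omega>) / sqrt (real n)) \<in> borel_measurable M" for n
    using meas by (intro borel_measurable_divide borel_measurable_sum) auto
  fix e :: real assume "e > 0"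
  \<comment> \<open>With this \<open>K\<close> the Markov bound for the squared sum is at most
    \<open>e\<close>; the maximum with 1 keeps \<open>K\<close> positive whatever \<open>C\<close>
    is.\<close>
  define K where "K = sqrt (max C 1 / e)"
  have K: "K > 0" "K\<^sup>2 = max C 1 / e" using \<open>e > 0\<close> by (auto simp: K_def)
  have "prob {\<omega>\<in>space M. \<bar>(\<Sum>i<n. U n i \<omega>) / sqrt (real n)\<bar> > K} \<le> e" if "n > 0" for n
  proof -
    let ?S = "\<lambda>\<omega>. (\<Sum>i<n. U n i \<omega>) / sqrt (real n)"
    have eq: "(?S \<omega>)\<^sup>2 = (\<Sum>i<n. \<Sum>j<n. U n i \<omega> * U n j \<omega>) / real n" for \<omega>
      by (simp add: power_divide power2_eq_square sum_product flip: real_sqrt_mult)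
    have int: "integrable M (\<lambda>\<omega>. U n i \<omega> * U n j \<omega>)" if "i < n" "j < n" for i j
      using orth[OF that] sq[OF that(1)] by (cases "i = j") (auto simp: power2_eq_square)
    have int_S: "integrable M (\<lambda>\<omega>. (?S \<omega>)\<^sup>2)"
      unfolding eq by (intro integrable_divide_zero Bochner_Integration.integrable_sum) (auto intro: int)
    have "expectation (\<lambda>\<omega>. \<Sum>i<n. \<Sum>j<n. U n i \<omega> * U n j \<omega>) =
        (\<Sum>i<n. expectation (\<lambda>\<omega>. \<Sum>j<n. U n i \<omega> * U n j \<omega>))"
      by (intro Bochner_Integration.integral_sum Bochner_Integration.integrable_sum) (auto intro: int)
    also have "\<dots> = (\<Sum>i<n. \<Sum>j<n. expectation (\<lambda>\<omega>. U n i \<omega> * U n j \<omega>))"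
      by (intro sum.cong refl Bochner_Integration.integral_sum) (auto intro: int)
    finally have "expectation (\<lambda>\<omega>. (?S \<omega>)\<^sup>2) =
        (\<Sum>i<n. \<Sum>j<n. expectation (\<lambda>\<omega>. U n i \<omega> * U n j \<omega>)) / real n"
      unfolding eq by simp
    also have "(\<Sum>i<n. \<Sum>j<n. expectation (\<lambda>\<omega>. U n i \<omega> * U n j \<omega>)) =
        (\<Sum>i<n. \<Sum>j<n. if i = j then expectation (\<lambda>\<omega>. (U n i \<omega>)\<^sup>2) else 0)"
      using orth by (intro sum.cong) (auto simp: power2_eq_square)
    also have "\<dots> \<le> (\<Sum>i<n. C)" by (intro sum_mono) (auto intro: bound)
    finally have E: "expectation (\<lambda>\<omega>. (?S \<omega>)\<^sup>2) \<le> C"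
      using that by (simp add: divide_right_mono pos_divide_le_eq mult.commute)
    have "K\<^sup>2 \<le> s\<^sup>2" if "K < \<bar>s\<bar>" for s
      using that K(1) power_mono[of K "\<bar>s\<bar>" 2] by simp
    moreover have "{\<omega>\<in>space M. (?S \<omega>)\<^sup>2 \<ge> K\<^sup>2} \<in> events"
      using m[of n] by measurable
    ultimately have "prob {\<omega>\<in>space M. \<bar>?S \<omega>\<bar> > K} \<le> prob {\<omega>\<in>space M. (?S \<omega>)\<^sup>2 \<ge> K\<^sup>2}"
      by (intro finite_measure_mono) blast+
    also have "\<dots> \<le> expectation (\<lambda>\<omega>. (?S \<omega>)\<^sup>2) / K\<^sup>2"
      using K(1) by (intro integral_Markov_inequality_measure[where A="{}"] int_S) auto
    also have "\<dots> \<le> max C 1 / K\<^sup>2"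
      using E by (intro divide_right_mono) auto
    also have "\<dots> = e" using K \<open>e > 0\<close> by (simp add: max_def)
    finally show ?thesis .
  qed
  then show "\<exists>K. \<forall>\<^sub>F n in sequentially. prob {\<omega>\<in>space M. \<bar>(\<Sum>i<n. U n i \<omega>) / sqrt (real n)\<bar> > K} \<le> e"
    by (intro exI eventually_mono[OF eventually_gt_at_top[of 0]])
qed

section \<open>Independence of functions of random elements of different types\<close>

lemma vimage_compose_subset:
  assumes [measurable]: "W \<in> M \<rightarrow>\<^sub>M L" "h \<in> L \<rightarrow>\<^sub>M L'"
  shows "{(\<lambda>\<omega>. h (W \<omega>)) -` A \<inter> space M |A. A \<in> sets L'} \<subseteq> {W -` A \<inter> space M |A. A \<in> sets L}"
proof clarify
  fix A assume [measurable]: "A \<in> sets L'"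
  have "(\<lambda>\<omega>. h (W \<omega>)) -` A \<inter> space M = W -` (h -` A \<inter> space L) \<inter> space M"
    using measurable_space[OF assms(1)] by auto
  moreover have "h -` A \<inter> space L \<in> sets L" by measurable
  ultimately show "\<exists>B. (\<lambda>\<omega>. h (W \<omega>)) -` A \<inter> space M = W -` B \<inter> space M \<and> B \<in> sets L" by blast
qed

lemma Int_stable_vimage: "Int_stable {W -` A \<inter> space M |A. A \<in> sets L}"
proof (rule Int_stableI, clarify)
  fix A B assume "A \<in> sets L" "B \<in> sets L"
  then show "\<exists>C. W -` A \<inter> space M \<inter> (W -` B \<inter> space M) = W -` C \<inter> space M \<and> C \<in> sets L"
    by (intro exI[of _ "A \<inter> B"]) auto
qed

text \<open>Bridge from \<open>indep_rv\<close> to the results on \<open>indep_var\<close>: the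
  inputs may have different value types, and mapping both into one common type makes
  \<open>indep_var\<close> applicable. The preimage systems of the composed variables are contained
  in the given ones, and intersection stability extends independence to the generated
  sigma-algebras.\<close>

lemma indep_rv_compose:
  assumes "indep_rv S U R V" "f \<in> S \<rightarrow>\<^sub>M S'" "g \<in> R \<rightarrow>\<^sub>M R'"
  shows "indep_var S' (\<lambda>\<omega>. f (U \<omega>)) R' (\<lambda>\<omega>. g (V \<omega>))"
proof -
  have [measurable]: "U \<in> M \<rightarrow>\<^sub>M S" "V \<in> M \<rightarrow>\<^sub>M R"
    using assms(1) by (auto simp: indep_rv_def)
  note [measurable] = assms(2,3)
  have "indep_set {(\<lambda>\<omega>. f (U \<omega>)) -` A \<inter> space M |A. A \<in> sets S'}
     {(\<lambda>\<omega>. g (V \<omega>)) -` A \<inter> space M |A. A \<in> sets R'}"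
    using assms(1) vimage_compose_subset[of U S f S'] vimage_compose_subset[of V R g R']
    unfolding indep_rv_def indep_set_def
    by (elim conjE indep_sets_mono_sets) (auto split: bool.split)
  then show ?thesis
    unfolding indep_var_eq by (intro conjI indep_set_sigma_sets Int_stable_vimage) measurable
qed

end

section \<open>Least squares algebra under diagonal dominance\<close>

text \<open>\<open>is_ols\<close> determines \<open>\<theta>\<close> only if the Gram matrix has a
  two-sided inverse, so one must be produced: \<open>inj\<close> says that the kernel is trivial,
  hence the determinant is nonzero. The conclusion has the form of normal equations because these
  carry over to another basis of the column space.\<close>

lemma ols_residual_orthogonal:
  fixes G :: "real mat" and Y \<theta> :: "real vec"
  assumes G: "G \<in> carrier_mat n m" and Y: "Y \<in> carrier_vec n" and ols: "is_ols G Y \<theta>"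
    and inj: "\<And>d. (\<And>k. k < m \<Longrightarrow> (\<Sum>i<n. G $$ (i, k) * (\<Sum>l<m. G $$ (i, l) * d l)) = 0) \<Longrightarrow>
      (\<And>k. k < m \<Longrightarrow> d k = 0)"
    and k: "k < m"
  shows "(\<Sum>i<n. G $$ (i, k) * (Y $ i - (\<Sum>l<m. G $$ (i, l) * \<theta> $ l))) = 0"
proof -
  let ?A = "transpose_mat G * G"
  have A: "?A \<in> carrier_mat m m" and Gt: "transpose_mat G \<in> carrier_mat m n" using G by auto
  have gram: "(transpose_mat G *\<^sub>v (G *\<^sub>v d)) $ k = (\<Sum>i<n. G $$ (i, k) * (\<Sum>l<m. G $$ (i, l) * d $ l))"
    if "d \<in> carrier_vec m" "k < m" for d k
    using that G by (auto simp: scalar_prod_def lessThan_atLeast0 intro!: sum.cong)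
  have "det ?A \<noteq> 0"
  proof
    assume "det ?A = 0"
    then obtain d where d: "d \<in> carrier_vec m" "d \<noteq> 0\<^sub>v m" "?A *\<^sub>v d = 0\<^sub>v m"
      using det_0_iff_vec_prod_zero_field[OF A] by auto
    have "transpose_mat G *\<^sub>v (G *\<^sub>v d) = 0\<^sub>v m"
      using d assoc_mult_mat_vec[OF Gt G d(1)] by simp
    then have "(\<Sum>i<n. G $$ (i, k) * (\<Sum>l<m. G $$ (i, l) * d $ l)) = 0" if "k < m" for k
      using gram[OF d(1) that] that by simp
    then have "d $ k = 0" if "k < m" for k using inj[of "\<lambda>k. d $ k"] that by blast
    then have "d = 0\<^sub>v m" using d(1) by (intro eq_vecI) auto
    with d(2) show False by simp
  qed
  \<comment> \<open>A nonzero determinant makes \<open>?A\<close> a unit of the ring of square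
    matrices; \<open>()\<close> fills the extension field of the ring record.\<close>
  from det_non_zero_imp_unit[OF A this, of "()"]
  obtain B where B: "B \<in> carrier_mat m m" "B * ?A = 1\<^sub>m m" "?A * B = 1\<^sub>m m"
    unfolding Units_def ring_mat_def by auto
  then have "inverts_mat ?A B" "inverts_mat B ?A" using A by (auto simp: inverts_mat_def)
  with ols have \<theta>: "\<theta> = (B * transpose_mat G) *\<^sub>v Y" "\<theta> \<in> carrier_vec m"
    using G by (auto simp: is_ols_def)
  have "transpose_mat G *\<^sub>v (G *\<^sub>v \<theta>) = ?A *\<^sub>v \<theta>"
    using assoc_mult_mat_vec[OF Gt G \<theta>(2)] by simp
  also have "\<dots> = ?A *\<^sub>v (B *\<^sub>v (transpose_mat G *\<^sub>v Y))"
    using assoc_mult_mat_vec[OF B(1) Gt Y] \<theta>(1) by simp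
  also have "\<dots> = (?A * B) *\<^sub>v (transpose_mat G *\<^sub>v Y)"
    using A B(1) Gt Y by (intro assoc_mult_mat_vec[symmetric]) auto
  also have "\<dots> = transpose_mat G *\<^sub>v Y" using B(3) Gt Y by simp
  finally have "(transpose_mat G *\<^sub>v (G *\<^sub>v \<theta>)) $ k = (transpose_mat G *\<^sub>v Y) $ k" by simp
  moreover have "(transpose_mat G *\<^sub>v Y) $ k = (\<Sum>i<n. G $$ (i, k) * Y $ i)"
    using k G Y by (auto simp: scalar_prod_def lessThan_atLeast0 intro!: sum.cong)
  ultimately show ?thesis
    using gram[OF \<theta>(2) k] by (simp add: right_diff_distrib sum_subtractf)
qed

text \<open>This norm of the off-diagonal part is a finite sum of absolute entries, so entrywise
  convergence in probability passes to it directly.\<close>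

definition offdiag :: "nat \<Rightarrow> (nat \<Rightarrow> nat \<Rightarrow> real) \<Rightarrow> real" where
  "offdiag m A = (\<Sum>k<m. \<Sum>l\<in>{..<m} - {k}. \<bar>A k l\<bar>)"

lemma offdiag_nonneg: "0 \<le> offdiag m A"
  by (auto simp: offdiag_def intro!: sum_nonneg)

text \<open>Every entry of \<open>v\<close> is bounded by the l1 norm of \<open>v\<close>. The set
  of rows is a parameter because the a priori bound sums over all rows, whereas the treatment
  contrast uses row 0 alone.\<close>

lemma offdiag_row_bound:
  assumes "K \<subseteq> {..<m}"
  shows "(\<Sum>k\<in>K. \<bar>\<Sum>l\<in>{..<m} - {k}. A k l * v l\<bar>) \<le> offdiag m A * (\<Sum>l<m. \<bar>v l\<bar>)"
proof -
  have fin: "finite K" using assms by (rule finite_subset) simp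
  have "(\<Sum>k\<in>K. \<bar>\<Sum>l\<in>{..<m} - {k}. A k l * v l\<bar>)
      \<le> (\<Sum>k\<in>K. \<Sum>l\<in>{..<m} - {k}. \<bar>A k l\<bar> * (\<Sum>l<m. \<bar>v l\<bar>))"
  proof (intro sum_mono)
    fix k
    have "\<bar>\<Sum>l\<in>{..<m} - {k}. A k l * v l\<bar> \<le> (\<Sum>l\<in>{..<m} - {k}. \<bar>A k l * v l\<bar>)"
      by (rule sum_abs)
    also have "\<dots> \<le> (\<Sum>l\<in>{..<m} - {k}. \<bar>A k l\<bar> * (\<Sum>l<m. \<bar>v l\<bar>))"
      unfolding abs_mult by (intro sum_mono mult_left_mono member_le_sum) auto
    finally show "\<bar>\<Sum>l\<in>{..<m} - {k}. A k l * v l\<bar> \<le> (\<Sum>l\<in>{..<m} - {k}. \<bar>A k l\<bar> * (\<Sum>l<m. \<bar>v l\<bar>))" .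
  qed
  also have "\<dots> \<le> (\<Sum>k<m. \<Sum>l\<in>{..<m} - {k}. \<bar>A k l\<bar> * (\<Sum>l<m. \<bar>v l\<bar>))"
    using assms by (intro sum_mono2) (auto intro!: sum_nonneg mult_nonneg_nonneg)
  finally show ?thesis by (simp add: offdiag_def sum_distrib_right)
qed

text \<open>Solve row \<open>k\<close> for its diagonal term and sum over the rows: the off-diagonal
  part contributes at most \<open>h / 2\<close> times the l1 norm of \<open>v\<close> and is
  absorbed on the left. With \<open>b = 0\<close> this is injectivity; with the scores as
  \<open>b\<close> it bounds the scaled estimation error.\<close>

lemma diagonally_dominant_bound:
  fixes A :: "nat \<Rightarrow> nat \<Rightarrow> real"
  assumes eq: "\<And>k. k < m \<Longrightarrow> (\<Sum>l<m. A k l * v l) = b k"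
    and h: "h > 0" "\<And>k. k < m \<Longrightarrow> h \<le> A k k" and off: "offdiag m A \<le> h / 2"
  shows "(\<Sum>k<m. \<bar>v k\<bar>) \<le> 2 / h * (\<Sum>k<m. \<bar>b k\<bar>)"
proof -
  let ?S = "\<Sum>k<m. \<bar>v k\<bar>"
  have "h * \<bar>v k\<bar> \<le> \<bar>b k\<bar> + \<bar>\<Sum>l\<in>{..<m} - {k}. A k l * v l\<bar>" if "k < m" for k
  proof -
    have "A k k * v k = b k - (\<Sum>l\<in>{..<m} - {k}. A k l * v l)"
      using eq[OF that] that by (simp add: sum.remove[of "{..<m}" k])
    moreover have "h * \<bar>v k\<bar> \<le> \<bar>A k k * v k\<bar>"
      using h(2)[OF that] unfolding abs_mult by (intro mult_right_mono) linarith+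
    ultimately show ?thesis by linarith
  qed
  then have "(\<Sum>k<m. h * \<bar>v k\<bar>) \<le> (\<Sum>k<m. \<bar>b k\<bar> + \<bar>\<Sum>l\<in>{..<m} - {k}. A k l * v l\<bar>)"
    by (intro sum_mono) auto
  then have "h * ?S \<le> (\<Sum>k<m. \<bar>b k\<bar>) + (\<Sum>k<m. \<bar>\<Sum>l\<in>{..<m} - {k}. A k l * v l\<bar>)"
    by (simp add: sum_distrib_left sum.distrib)
  also have "(\<Sum>k<m. \<bar>\<Sum>l\<in>{..<m} - {k}. A k l * v l\<bar>) \<le> offdiag m A * ?S"
    by (intro offdiag_row_bound) simp
  also have "offdiag m A * ?S \<le> h / 2 * ?S"
    by (intro mult_right_mono off sum_nonneg) auto
  finally show ?thesis using h(1) by (simp add: field_simps)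
qed

lemma sum_lessThan_plus_2: "(\<Sum>k<p + 2. f k) = f 0 + f 1 + (\<Sum>k<p. f (k + 2))"
  for f :: "nat \<Rightarrow> 'b::comm_monoid_add"
  by (simp add: sum.lessThan_Suc_shift add.assoc del: sum.lessThan_Suc)

text \<open>Deterministic core, for one realization with a diagonally dominant Gram matrix. In the
  regressors \<open>w\<close> the normal equations say that \<open>A\<close> maps the scaled
  coefficient error to \<open>b\<close>. Row 0 gives the leading coefficient as \<open>b 0\<close>
  up to off-diagonal terms, and the a priori bound with constant \<open>2 / h\<close> controls
  these. The contrast is twice that coefficient, whence \<open>2 * b 0\<close> and
  \<open>4 / h\<close>.\<close>

lemma ols_contrast_expansion:
  fixes n p :: nat and \<mu>\<^sub>1 \<mu>\<^sub>2 :: real and t r \<beta> :: "nat \<Rightarrow> real" and z :: "nat \<Rightarrow> nat \<Rightarrow> real" and \<theta> :: "real vec"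
  defines "w \<equiv> \<lambda>k i. if k = 0 then 2 * t i - 1 else if k = 1 then 1 else z i (k - 2)"
  defines "A \<equiv> \<lambda>k l. (\<Sum>i<n. w k i * w l i) / real n"
  defines "b \<equiv> \<lambda>k. (\<Sum>i<n. w k i * r i) / sqrt (real n)"
  defines "G \<equiv> mat n (p + 2) (\<lambda>(i, k). if k = 0 then t i else if k = 1 then 1 - t i else z i (k - 2))"
  defines "Y \<equiv> vec n (\<lambda>i. \<mu>\<^sub>1 * t i + \<mu>\<^sub>2 * (1 - t i) + (\<Sum>k<p. \<beta> k * z i k) + r i)"
  assumes n: "n > 0" and t: "\<And>i. i < n \<Longrightarrow> t i \<in> {0, 1}" and ols: "is_ols G Y \<theta>"
    and h: "h > 0" "\<And>k. k < p + 2 \<Longrightarrow> h \<le> A k k" and off: "offdiag (p + 2) A \<le> h / 2"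
  shows "\<bar>sqrt (real n) * ((\<theta> $ 0 - \<theta> $ 1) - (\<mu>\<^sub>1 - \<mu>\<^sub>2)) - 2 * b 0\<bar>
    \<le> 4 / h * (offdiag (p + 2) A * (\<Sum>k<p + 2. \<bar>b k\<bar>))"
proof -
  \<comment> \<open>Coordinates in the regressors \<open>w\<close>: since
    \<open>t = (1 + w) / 2\<close> and \<open>1 - t = (1 - w) / 2\<close> for the sign
    \<open>w\<close>, coefficients \<open>d 0\<close>, \<open>d 1\<close> become half their
    difference on the sign and half their sum on the constant.\<close>
  define v where "v d k = (if k = 0 then (d 0 - d 1) / 2 else if k = 1 then (d 0 + d 1) / 2 else d k)"
    for d :: "nat \<Rightarrow> real" and k :: nat
  have [simp]: "w 0 i = 2 * t i - 1" "w (Suc 0) i = 1" "w (Suc (Suc k)) i = z i k" for i k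
    by (auto simp: w_def)
  have G: "G $$ (i, 0) = t i" "G $$ (i, Suc 0) = 1 - t i" "k < p \<Longrightarrow> G $$ (i, Suc (Suc k)) = z i k"
    if "i < n" for i k using that by (auto simp: G_def)
  have fit: "(\<Sum>l<p + 2. G $$ (i, l) * d l) = (\<Sum>l<p + 2. w l i * v d l)" if "i < n" for i d
    unfolding sum_lessThan_plus_2 using that by (simp add: G v_def field_simps)
  have score: "(\<Sum>i<n. w k i * u i) = 0"
    if u: "\<And>k. k < p + 2 \<Longrightarrow> (\<Sum>i<n. G $$ (i, k) * u i) = 0" and k: "k < p + 2" for u k
  proof -
    have u01: "(\<Sum>i<n. t i * u i) = 0" "(\<Sum>i<n. (1 - t i) * u i) = 0"
      using u[of 0] u[of "Suc 0"] by (simp_all add: G)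
    have "k = 0 \<or> k = 1 \<or> (\<exists>l<p. k = Suc (Suc l))" using k by presburger
    then show ?thesis
    proof (elim disjE exE conjE)
      assume "k = 0"
      then have "(\<Sum>i<n. w k i * u i) = (\<Sum>i<n. t i * u i) - (\<Sum>i<n. (1 - t i) * u i)"
        by (simp add: sum_subtractf[symmetric] algebra_simps)
      then show ?thesis using u01 by simp
    next
      assume "k = 1"
      then have "(\<Sum>i<n. w k i * u i) = (\<Sum>i<n. t i * u i) + (\<Sum>i<n. (1 - t i) * u i)"
        by (simp add: sum.distrib[symmetric] algebra_simps)
      then show ?thesis using u01 by simp
    next
      fix l assume "l < p" "k = Suc (Suc l)"
      then show ?thesis using u[of k] by (simp add: G)
    qed
  qed
  \<comment> \<open>The value \<open>c = 1\<close> serves the injectivity argument,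
    \<open>c = sqrt (real n)\<close> the normalized equations.\<close>
  have scale: "(\<Sum>l<p + 2. A k l * (c * e l)) = c / real n * (\<Sum>i<n. w k i * (\<Sum>l<p + 2. w l i * e l))"
    for k c e
    by (simp only: A_def sum_distrib_left sum_distrib_right sum_divide_distrib)
       (subst sum.swap, simp add: algebra_simps)
  have res: "(\<Sum>i<n. G $$ (i, k) * (Y $ i - (\<Sum>l<p + 2. G $$ (i, l) * \<theta> $ l))) = 0" if "k < p + 2" for k
  proof (rule ols_residual_orthogonal[OF _ _ ols])
    fix d k
    assume d: "\<And>k. k < p + 2 \<Longrightarrow> (\<Sum>i<n. G $$ (i, k) * (\<Sum>l<p + 2. G $$ (i, l) * d l)) = 0"
      and k: "k < p + 2"
    \<comment> \<open>Orthogonality to the columns of \<open>G\<close> passes to the regressors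
      \<open>w\<close>, which yields a homogeneous system for the diagonally dominant
      \<open>A\<close>.\<close>
    have "(\<Sum>l<p + 2. A k l * v d l) = 0" if "k < p + 2" for k
    proof -
      have "(\<Sum>i<n. w k i * (\<Sum>l<p + 2. w l i * v d l)) =
          (\<Sum>i<n. w k i * (\<Sum>l<p + 2. G $$ (i, l) * d l))"
        by (intro sum.cong refl) (simp only: fit lessThan_iff)
      also have "\<dots> = 0" by (rule score[OF d that])
      finally show ?thesis using scale[of k 1 "v d"] by (simp del: sum.lessThan_Suc)
    qed
    from diagonally_dominant_bound[of "p + 2" A "v d" "\<lambda>_. 0", OF this h off]
    have "(\<Sum>k<p + 2. \<bar>v d k\<bar>) \<le> 0" by simp
    then have "(\<Sum>k<p + 2. \<bar>v d k\<bar>) = 0" by (intro antisym sum_nonneg) auto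
    then have v0: "v d k = 0" if "k < p + 2" for k
      using that by (subst (asm) sum_nonneg_eq_0_iff) auto
    show "d k = 0"
      using v0[of 0] v0[of 1] v0[of k] k by (auto simp: v_def split: if_splits)
  qed (use that in \<open>auto simp: G_def Y_def\<close>)
  \<comment> \<open>In terms of the coefficient error the modelled part of \<open>Y\<close> cancels,
    and the residual is \<open>r\<close> minus the fit of this error.\<close>
  define d where "d k = \<theta> $ k - (if k = 0 then \<mu>\<^sub>1 else if k = 1 then \<mu>\<^sub>2 else \<beta> (k - 2))" for k
  have "Y $ i - (\<Sum>l<p + 2. G $$ (i, l) * \<theta> $ l) = r i - (\<Sum>l<p + 2. w l i * v d l)" if "i < n" for i
    unfolding fit[OF that, symmetric] unfolding sum_lessThan_plus_2 using that
    by (simp add: Y_def G d_def algebra_simps sum_subtractf)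
  with res have "(\<Sum>i<n. G $$ (i, k) * (r i - (\<Sum>l<p + 2. w l i * v d l))) = 0" if "k < p + 2" for k
    using that by simp
  from score[OF this] have *: "(\<Sum>i<n. w k i * (\<Sum>l<p + 2. w l i * v d l)) = (\<Sum>i<n. w k i * r i)"
    if "k < p + 2" for k
    using that by (simp add: right_diff_distrib sum_subtractf)
  have eq: "(\<Sum>l<p + 2. A k l * (sqrt (real n) * v d l)) = b k" if "k < p + 2" for k
    unfolding scale *[OF that] b_def using n by (simp add: divide_simps)
  let ?S = "\<Sum>l<p + 2. \<bar>sqrt (real n) * v d l\<bar>"
  have S: "?S \<le> 2 / h * (\<Sum>k<p + 2. \<bar>b k\<bar>)"
    by (rule diagonally_dominant_bound[OF eq h off])
  \<comment> \<open>For \<open>t\<close> in {0, 1} the regressor \<open>w 0\<close> is a sign, so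
    the leading diagonal entry is exactly 1 and the leading term is \<open>b 0\<close>
    itself.\<close>
  have "A 0 0 = 1"
  proof -
    have "w 0 i * w 0 i = 1" if "i < n" for i using t[OF that] by auto
    then show ?thesis using n by (simp add: A_def)
  qed
  moreover have "(\<Sum>l<p + 2. A 0 l * (sqrt (real n) * v d l)) =
      A 0 0 * (sqrt (real n) * v d 0) + (\<Sum>l\<in>{..<p + 2} - {0}. A 0 l * (sqrt (real n) * v d l))"
    by (rule sum.remove) auto
  ultimately have "sqrt (real n) * v d 0 - b 0 = - (\<Sum>l\<in>{..<p + 2} - {0}. A 0 l * (sqrt (real n) * v d l))"
    using eq[of 0] by simp
  moreover have "sqrt (real n) * ((\<theta> $ 0 - \<theta> $ 1) - (\<mu>\<^sub>1 - \<mu>\<^sub>2)) = 2 * (sqrt (real n) * v d 0)"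
    by (simp add: v_def d_def)
  ultimately have "\<bar>sqrt (real n) * ((\<theta> $ 0 - \<theta> $ 1) - (\<mu>\<^sub>1 - \<mu>\<^sub>2)) - 2 * b 0\<bar>
      = 2 * \<bar>\<Sum>l\<in>{..<p + 2} - {0}. A 0 l * (sqrt (real n) * v d l)\<bar>"
    by linarith
  also have "\<dots> \<le> 2 * (offdiag (p + 2) A * ?S)"
    using offdiag_row_bound[of "{0}" "p + 2" A "\<lambda>l. sqrt (real n) * v d l"] by simp
  also have "\<dots> \<le> 2 * (offdiag (p + 2) A * (2 / h * (\<Sum>k<p + 2. \<bar>b k\<bar>)))"
    by (intro mult_left_mono S offdiag_nonneg) simp
  also have "\<dots> = 4 / h * (offdiag (p + 2) A * (\<Sum>k<p + 2. \<bar>b k\<bar>))"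
    by (simp del: sum.lessThan_Suc)
  finally show ?thesis .
qed

section \<open>Characteristic functions and weak convergence\<close>

context prob_space
begin

text \<open>Slutsky's argument for characteristic functions: the exponentials differ by at most
  \<open>\<bar>t\<bar> * d\<close> where the variables differ by at most \<open>d\<close>, and by at
  most 2 on the remaining event, whose probability vanishes.\<close>

lemma char_tendsto_null_perturbation:
  assumes [measurable]: "\<And>n. S n \<in> borel_measurable M" "\<And>n. V n \<in> borel_measurable M"
    and null: "null_in_prob (\<lambda>n \<omega>. S n \<omega> - V n \<omega>)"
    and lim: "(\<lambda>n. char (distr M borel (V n)) t) \<longlonglongrightarrow> c"
  shows "(\<lambda>n. char (distr M borel (S n)) t) \<longlonglongrightarrow> c"
proof -
  have "(\<lambda>n. cmod (char (distr M borel (S n)) t - char (distr M borel (V n)) t)) \<longlonglongrightarrow> 0"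
  proof (rule tendsto_zero_if_eventually_le)
    fix e :: real assume "e > 0"
    \<comment> \<open>Both contributions stay below \<open>e / 2\<close>:
      \<open>\<bar>t\<bar> * d\<close> by this choice, where the added 1 covers
      \<open>t = 0\<close>, and twice a probability that is eventually below
      \<open>e / 4\<close>.\<close>
    define d where "d = e / (2 * (\<bar>t\<bar> + 1))"
    have d: "d > 0" "\<bar>t\<bar> * d \<le> e / 2"
      using \<open>e > 0\<close> by (auto simp: d_def field_simps)
    have "\<forall>\<^sub>F n in sequentially. prob {\<omega>\<in>space M. \<bar>S n \<omega> - V n \<omega>\<bar> > d} < e / 4"
      using null_in_probD[OF null d(1)] \<open>e > 0\<close> by (intro order_tendstoD(2)) auto
    then show "\<forall>\<^sub>F n in sequentially.
        cmod (char (distr M borel (S n)) t - char (distr M borel (V n)) t) \<le> e"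
    proof eventually_elim
      case (elim n)
      let ?B = "{\<omega>\<in>space M. \<bar>S n \<omega> - V n \<omega>\<bar> > d}"
      have bound: "cmod (iexp (t * S n \<omega>) - iexp (t * V n \<omega>)) \<le> \<bar>t\<bar> * d + 2 * indicator ?B \<omega>"
        if "\<omega> \<in> space M" for \<omega>
      proof (cases "\<omega> \<in> ?B")
        case True
        have "cmod (iexp (t * S n \<omega>) - iexp (t * V n \<omega>)) \<le> 1 + 1"
          by (rule order_trans[OF norm_triangle_ineq4]) (simp del: of_real_mult)
        also have "\<dots> \<le> \<bar>t\<bar> * d + 2 * indicator ?B \<omega>"
          using True d(1) by simp
        finally show ?thesis .
      next
        case False
        have "iexp (t * S n \<omega>) - iexp (t * V n \<omega>) =
            iexp (t * V n \<omega>) * (iexp (t * (S n \<omega> - V n \<omega>)) - 1)"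
          by (simp add: algebra_simps exp_add[symmetric])
        then have "cmod (iexp (t * S n \<omega>) - iexp (t * V n \<omega>)) = cmod (iexp (t * (S n \<omega> - V n \<omega>)) - 1)"
          by (simp add: norm_mult del: of_real_mult)
        also have "\<dots> \<le> \<bar>t * (S n \<omega> - V n \<omega>)\<bar>"
          using iexp_approx1[of "t * (S n \<omega> - V n \<omega>)" 0] by simp
        also have "\<dots> \<le> \<bar>t\<bar> * d"
          using False that unfolding abs_mult by (intro mult_left_mono) auto
        finally show ?thesis using False by simp
      qed
      have "char (distr M borel (S n)) t - char (distr M borel (V n)) t =
          (CLINT \<omega>|M. iexp (t * S n \<omega>) - iexp (t * V n \<omega>))"
        unfolding char_def
        by (subst (1 2) integral_distr, measurable, measurable)
           (intro Bochner_Integration.integral_diff[symmetric] integrable_iexp, auto)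
      also have "cmod \<dots> \<le> (LINT \<omega>|M. cmod (iexp (t * S n \<omega>) - iexp (t * V n \<omega>)))"
        by (rule integral_norm_bound)
      also have "\<dots> \<le> (LINT \<omega>|M. \<bar>t\<bar> * d + 2 * indicator ?B \<omega>)"
      proof (rule integral_mono)
        show "integrable M (\<lambda>\<omega>. cmod (iexp (t * S n \<omega>) - iexp (t * V n \<omega>)))"
          by (intro integrable_norm Bochner_Integration.integrable_diff integrable_iexp) auto
        show "integrable M (\<lambda>\<omega>. \<bar>t\<bar> * d + 2 * indicator ?B \<omega>)"
          using d(1) by (intro integrable_const_bound[of _ "\<bar>t\<bar> * d + 2"]) (auto split: split_indicator)
      qed (rule bound)
      also have "\<dots> = \<bar>t\<bar> * d + 2 * prob ?B"
      proof -
        have "integrable M (indicator ?B :: 'a \<Rightarrow> real)"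
          by (intro integrable_real_indicator) (auto simp: less_top[symmetric])
        then show ?thesis by (subst Bochner_Integration.integral_add) (auto simp: prob_space)
      qed
      finally show ?case using elim d(2) by linarith
    qed
  qed simp
  then have "(\<lambda>n. char (distr M borel (S n)) t - char (distr M borel (V n)) t) \<longlonglongrightarrow> 0"
    by (simp add: tendsto_norm_zero_iff)
  from tendsto_add[OF this lim] show ?thesis by simp
qed

text \<open>Second-order expansion with a remainder that needs second moments only: the minimum in
  the remainder is dominated by \<open>6 * (X \<omega>)\<^sup>2\<close> and tends to 0 pointwise.
  The sign \<open>a\<close> enters through its square and absolute value, so one
  \<open>\<rho>\<close> serves both signs; the form \<open>\<rho> n / real n\<close> lets
  \<open>n\<close> factors add up to \<open>\<rho> n\<close>.\<close>

lemma char_scaled_error: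
  assumes X: "X \<in> borel_measurable M" "integrable M X" "integrable M (\<lambda>\<omega>. (X \<omega>)\<^sup>2)"
    and mean: "expectation X = 0" and var: "variance X = \<sigma>\<^sup>2"
  obtains \<rho> :: "nat \<Rightarrow> real" where "\<rho> \<longlonglongrightarrow> 0"
    and "\<And>n a. n > 0 \<Longrightarrow> \<bar>a\<bar> = 1 \<Longrightarrow>
      cmod (char (distr M borel X) (s * a / sqrt (real n)) - of_real (1 - s\<^sup>2 * \<sigma>\<^sup>2 / 2 / real n)) \<le> \<rho> n / real n"
proof
  let ?I = "\<lambda>n. LINT \<omega>|M. min (6 * (X \<omega>)\<^sup>2) (\<bar>s\<bar> / sqrt (real n) * \<bar>X \<omega>\<bar> ^ 3)"
  have "(\<lambda>n. \<bar>s\<bar> / sqrt (real n) * c) \<longlonglongrightarrow> 0" for c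
    by (intro tendsto_mult_left_zero tendsto_divide_0[OF tendsto_const] filterlim_at_top_imp_at_infinity
        filterlim_compose[OF sqrt_at_top] filterlim_real_sequentially)
  then have "(\<lambda>n. min (6 * (X \<omega>)\<^sup>2) (\<bar>s\<bar> / sqrt (real n) * \<bar>X \<omega>\<bar> ^ 3)) \<longlonglongrightarrow> min (6 * (X \<omega>)\<^sup>2) 0" for \<omega>
    by (intro tendsto_min tendsto_const)
  then have "?I \<longlonglongrightarrow> (LINT \<omega>|M. 0)"
    using X(1,3) by (intro integral_dominated_convergence[where w = "\<lambda>\<omega>. 6 * (X \<omega>)\<^sup>2"]) auto
  then show "(\<lambda>n. s\<^sup>2 / 6 * ?I n) \<longlonglongrightarrow> 0"
    by (intro tendsto_mult_right_zero) simp
  fix n :: nat and a :: real assume "n > 0" "\<bar>a\<bar> = 1"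
  then have a: "a\<^sup>2 = 1" by (metis one_power2 power2_abs)
  have "cmod (char (distr M borel X) (s * a / sqrt (real n)) - of_real (1 - (s * a / sqrt (real n))\<^sup>2 * \<sigma>\<^sup>2 / 2))
    \<le> (s * a / sqrt (real n))\<^sup>2 / 6 * (LINT \<omega>|M. min (6 * (X \<omega>)\<^sup>2) (\<bar>s * a / sqrt (real n)\<bar> * \<bar>X \<omega>\<bar> ^ 3))"
    using char_approx3'[OF X mean var refl, of "s * a / sqrt (real n)"] by simp
  also have "(s * a / sqrt (real n))\<^sup>2 = s\<^sup>2 / real n"
    using a by (simp add: power_divide power_mult_distrib)
  also have "\<bar>s * a / sqrt (real n)\<bar> = \<bar>s\<bar> / sqrt (real n)"
    using \<open>\<bar>a\<bar> = 1\<close> by (simp add: abs_mult)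
  finally show "cmod (char (distr M borel X) (s * a / sqrt (real n)) - of_real (1 - s\<^sup>2 * \<sigma>\<^sup>2 / 2 / real n))
      \<le> s\<^sup>2 / 6 * ?I n / real n"
    by (simp add: mult_ac)
qed

text \<open>The continuous bounded test function \<open>min 1 (\<bar>z j\<bar> / K)\<close>
  dominates the indicator of the tail event, and its expectation under the limit law is at most the
  first absolute moment of \<open>\<xi> j\<close> divided by \<open>K\<close>.\<close>

lemma weak_conv_vec_bounded_in_prob:
  assumes conv: "weak_conv_vec J (\<lambda>n. distr M (borel_vec J) (rvec J (V n))) (distr N (borel_vec J) (rvec J \<xi>))"
    and N: "prob_space N" and j: "j \<in> J"
    and V: "\<And>n j. j \<in> J \<Longrightarrow> V n j \<in> borel_measurable M"
    and \<xi>: "\<And>j. j \<in> J \<Longrightarrow> \<xi> j \<in> borel_measurable N" and int: "integrable N (\<xi> j)"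
  shows "bounded_in_prob (\<lambda>n. V n j)"
  unfolding bounded_in_prob_def
proof (intro conjI allI impI V j)
  interpret N: prob_space N by fact
  note [measurable] = V[OF j] \<xi>[OF j]
  have rv [measurable]: "rvec J (V n) \<in> M \<rightarrow>\<^sub>M borel_vec J" "rvec J \<xi> \<in> N \<rightarrow>\<^sub>M borel_vec J" for n
    using V \<xi> by (auto intro!: measurable_restrict)
  have [measurable]: "(\<lambda>z. z j) \<in> borel_vec J \<rightarrow>\<^sub>M borel"
    using j by (rule measurable_component_singleton)
  fix e :: real assume "e > 0"
  \<comment> \<open>Chosen so that the first absolute moment divided by \<open>K\<close> is strictly
    below \<open>e\<close>; the added 1 keeps \<open>K\<close> positive if that moment is 0.\<close>
  define K where "K = 2 * (N.expectation (\<lambda>\<omega>. \<bar>\<xi> j \<omega>\<bar>) + 1) / e"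
  have E: "N.expectation (\<lambda>\<omega>. \<bar>\<xi> j \<omega>\<bar>) \<ge> 0" by simp
  then have K: "K > 0"
    unfolding K_def using \<open>e > 0\<close> by (intro divide_pos_pos mult_pos_pos) linarith+
  define f where "f = (\<lambda>z :: 'b \<Rightarrow> real. min 1 (\<bar>z j\<bar> / K))"
  have [measurable]: "f \<in> borel_vec J \<rightarrow>\<^sub>M borel" unfolding f_def by measurable
  have "continuous_map (product_topology (\<lambda>_. euclideanreal) J) euclideanreal ((\<lambda>y. min 1 (\<bar>y\<bar> / K)) \<circ> (\<lambda>z. z j))"
    using j K by (intro continuous_map_compose[OF continuous_map_product_projection])
      (auto intro!: continuous_intros)
  moreover have "bounded (f ` (PiE J (\<lambda>_. UNIV)))"
    using K by (intro boundedI[of _ 1]) (auto simp: f_def min_def)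
  ultimately have "(\<lambda>n. \<integral>z. f z \<partial>distr M (borel_vec J) (rvec J (V n)))
      \<longlonglongrightarrow> (\<integral>z. f z \<partial>distr N (borel_vec J) (rvec J \<xi>))"
    using conv unfolding weak_conv_vec_def f_def comp_def by blast
  then have lim: "(\<lambda>n. expectation (\<lambda>\<omega>. min 1 (\<bar>V n j \<omega>\<bar> / K))) \<longlonglongrightarrow> N.expectation (\<lambda>\<omega>. min 1 (\<bar>\<xi> j \<omega>\<bar> / K))"
    using j by (simp add: integral_distr f_def)
  have "N.expectation (\<lambda>\<omega>. min 1 (\<bar>\<xi> j \<omega>\<bar> / K)) \<le> N.expectation (\<lambda>\<omega>. \<bar>\<xi> j \<omega>\<bar> / K)"
  proof (rule integral_mono)
    show "integrable N (\<lambda>\<omega>. min 1 (\<bar>\<xi> j \<omega>\<bar> / K))"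
      using K by (intro N.integrable_const_bound[of _ 1]) (auto simp: min_def)
  qed (use int in auto)
  also have "\<dots> = N.expectation (\<lambda>\<omega>. \<bar>\<xi> j \<omega>\<bar>) / K" by simp
  also have "\<dots> < e"
  proof -
    have "e * K = 2 * (N.expectation (\<lambda>\<omega>. \<bar>\<xi> j \<omega>\<bar>) + 1)" using \<open>e > 0\<close> by (simp add: K_def)
    moreover have "y < 2 * (y + 1)" if "0 \<le> y" for y :: real using that by simp
    ultimately have "N.expectation (\<lambda>\<omega>. \<bar>\<xi> j \<omega>\<bar>) < e * K" using E by (simp only:)
    then show ?thesis using K by (simp only: pos_divide_less_eq)
  qed
  finally have "\<forall>\<^sub>F n in sequentially. expectation (\<lambda>\<omega>. min 1 (\<bar>V n j \<omega>\<bar> / K)) < e"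
    using lim by (intro order_tendstoD(2))
  then show "\<exists>K. \<forall>\<^sub>F n in sequentially. prob {\<omega>\<in>space M. \<bar>V n j \<omega>\<bar> > K} \<le> e"
  proof (intro exI[of _ K], eventually_elim)
    case (elim n)
    have "prob {\<omega>\<in>space M. \<bar>V n j \<omega>\<bar> > K} \<le> prob {\<omega>\<in>space M. min 1 (\<bar>V n j \<omega>\<bar> / K) \<ge> 1}"
      using K by (intro finite_measure_mono) auto
    also have "\<dots> \<le> expectation (\<lambda>\<omega>. min 1 (\<bar>V n j \<omega>\<bar> / K)) / 1"
      using K by (intro integral_Markov_inequality_measure[where A="{}"] integrable_const_bound[of _ 1])
        (auto simp: min_def)
    finally show ?case using elim by simp
  qed
qed

text \<open>\<open>weak_conv_vec\<close> tests with real functions, so the cosine and the sine of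
  the linear form are treated separately. The subset \<open>I\<close> permits linear forms in the
  omitted covariates alone.\<close>

lemma weak_conv_vec_char:
  assumes conv: "weak_conv_vec J (\<lambda>n. distr M (borel_vec J) (rvec J (V n))) (distr N (borel_vec J) (rvec J \<xi>))"
    and N: "prob_space N" and I: "finite I" "I \<subseteq> J"
    and V: "\<And>n j. j \<in> J \<Longrightarrow> V n j \<in> borel_measurable M"
    and \<xi>: "\<And>j. j \<in> J \<Longrightarrow> \<xi> j \<in> borel_measurable N"
  shows "(\<lambda>n. CLINT \<omega>|M. iexp (\<Sum>j\<in>I. c j * V n j \<omega>)) \<longlonglongrightarrow> (CLINT \<omega>|N. iexp (\<Sum>j\<in>I. c j * \<xi> j \<omega>))"
proof -
  interpret N: prob_space N by fact
  have [measurable]: "V n j \<in> borel_measurable M" "\<xi> j \<in> borel_measurable N" if "j \<in> I" for n j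
    using V \<xi> I(2) that by auto
  have rv [measurable]: "rvec J (V n) \<in> M \<rightarrow>\<^sub>M borel_vec J" "rvec J \<xi> \<in> N \<rightarrow>\<^sub>M borel_vec J" for n
    using V \<xi> by (auto intro!: measurable_restrict)
  have [measurable]: "(\<lambda>z. z j) \<in> borel_vec J \<rightarrow>\<^sub>M borel" if "j \<in> I" for j
    using that I(2) by (intro measurable_component_singleton) auto
  have real_conv: "(\<lambda>n. expectation (\<lambda>\<omega>. g (\<Sum>j\<in>I. c j * V n j \<omega>)))
      \<longlonglongrightarrow> N.expectation (\<lambda>\<omega>. g (\<Sum>j\<in>I. c j * \<xi> j \<omega>))"
    if g: "continuous_on UNIV g" "\<And>y. \<bar>g y\<bar> \<le> 1" for g :: "real \<Rightarrow> real"
  proof -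
    have [measurable]: "g \<in> borel \<rightarrow>\<^sub>M borel" using g(1) by (rule borel_measurable_continuous_onI)
    have "continuous_map (product_topology (\<lambda>_. euclideanreal) J) euclideanreal (g \<circ> (\<lambda>z. \<Sum>j\<in>I. c j * z j))"
      using g(1) I
      by (intro continuous_map_compose[where X'=euclideanreal] continuous_map_sum continuous_map_real_mult
          continuous_map_product_projection) auto
    moreover have "bounded ((\<lambda>z. g (\<Sum>j\<in>I. c j * z j)) ` (PiE J (\<lambda>_. UNIV)))"
      by (intro boundedI[of _ 1]) (use g(2) in auto)
    ultimately have "(\<lambda>n. \<integral>z. g (\<Sum>j\<in>I. c j * z j) \<partial>distr M (borel_vec J) (rvec J (V n)))
        \<longlonglongrightarrow> (\<integral>z. g (\<Sum>j\<in>I. c j * z j) \<partial>distr N (borel_vec J) (rvec J \<xi>))"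
      using conv unfolding weak_conv_vec_def comp_def by blast
    then have "(\<lambda>n. expectation (\<lambda>\<omega>. g (\<Sum>j\<in>I. c j * rvec J (V n) \<omega> j)))
        \<longlonglongrightarrow> N.expectation (\<lambda>\<omega>. g (\<Sum>j\<in>I. c j * rvec J \<xi> \<omega> j))"
      by (simp add: integral_distr)
    moreover have "(\<Sum>j\<in>I. c j * rvec J (V n) \<omega> j) = (\<Sum>j\<in>I. c j * V n j \<omega>)" for n \<omega>
      using I(2) by (intro sum.cong) auto
    moreover have "(\<Sum>j\<in>I. c j * rvec J \<xi> \<omega> j) = (\<Sum>j\<in>I. c j * \<xi> j \<omega>)" for \<omega>
      using I(2) by (intro sum.cong) auto
    ultimately show ?thesis by (simp only:)
  qed
  have iexp_eq: "iexp y = of_real (cos y) + \<i> * of_real (sin y)" for y :: real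
    by (simp add: exp_Euler cos_of_real sin_of_real)
  have eqM: "(CLINT \<omega>|M. iexp (W \<omega>)) = of_real (LINT \<omega>|M. cos (W \<omega>)) + \<i> * of_real (LINT \<omega>|M. sin (W \<omega>))"
    if [measurable]: "W \<in> borel_measurable M" for W
  proof -
    have "integrable M (\<lambda>\<omega>. cos (W \<omega>))" "integrable M (\<lambda>\<omega>. sin (W \<omega>))"
      by (auto intro!: integrable_const_bound[of _ 1])
    then show ?thesis unfolding iexp_eq by (subst Bochner_Integration.integral_add) auto
  qed
  have eqN: "(CLINT \<omega>|N. iexp (W \<omega>)) = of_real (LINT \<omega>|N. cos (W \<omega>)) + \<i> * of_real (LINT \<omega>|N. sin (W \<omega>))"
    if [measurable]: "W \<in> borel_measurable N" for W
  proof -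
    have "integrable N (\<lambda>\<omega>. cos (W \<omega>))" "integrable N (\<lambda>\<omega>. sin (W \<omega>))"
      by (auto intro!: N.integrable_const_bound[of _ 1])
    then show ?thesis unfolding iexp_eq by (subst Bochner_Integration.integral_add) auto
  qed
  have "(\<lambda>n. complex_of_real (expectation (\<lambda>\<omega>. cos (\<Sum>j\<in>I. c j * V n j \<omega>))) +
        \<i> * complex_of_real (expectation (\<lambda>\<omega>. sin (\<Sum>j\<in>I. c j * V n j \<omega>))))
      \<longlonglongrightarrow> of_real (N.expectation (\<lambda>\<omega>. cos (\<Sum>j\<in>I. c j * \<xi> j \<omega>))) +
        \<i> * of_real (N.expectation (\<lambda>\<omega>. sin (\<Sum>j\<in>I. c j * \<xi> j \<omega>)))"
    by (intro tendsto_add tendsto_mult tendsto_const tendsto_of_real real_conv)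
       (auto intro!: continuous_intros)
  then show ?thesis by (subst eqM, measurable, subst eqN, measurable)
qed

lemma indep_vars_mult:
  fixes U :: "'i \<Rightarrow> 'a \<Rightarrow> real"
  assumes "indep_vars (\<lambda>_. borel) U I" "i \<in> I" "j \<in> I" "i \<noteq> j" "integrable M (U i)" "integrable M (U j)"
  shows "integrable M (\<lambda>\<omega>. U i \<omega> * U j \<omega>)"
    and "expectation (\<lambda>\<omega>. U i \<omega> * U j \<omega>) = expectation (U i) * expectation (U j)"
proof -
  have "indep_vars (\<lambda>_. borel) U {i, j}" using assms(1) by (rule indep_vars_subset) (use assms(2,3) in auto)
  then have prod: "integrable M (\<lambda>\<omega>. \<Prod>k\<in>{i, j}. U k \<omega>)"
    "expectation (\<lambda>\<omega>. \<Prod>k\<in>{i, j}. U k \<omega>) = (\<Prod>k\<in>{i, j}. expectation (U k))"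
    using assms(5,6) indep_vars_integrable[of "{i, j}" U] indep_vars_lebesgue_integral[of "{i, j}" U]
    by blast+
  have eq: "(\<Prod>k\<in>{i, j}. f k) = f i * f j" for f :: "'i \<Rightarrow> real"
    using \<open>i \<noteq> j\<close> by simp
  show "integrable M (\<lambda>\<omega>. U i \<omega> * U j \<omega>)"
    "expectation (\<lambda>\<omega>. U i \<omega> * U j \<omega>) = expectation (U i) * expectation (U j)"
    using prod unfolding eq by blast+
qed

lemma integrable_mult_square:
  fixes U V :: "'a \<Rightarrow> real"
  assumes [measurable]: "U \<in> borel_measurable M" "V \<in> borel_measurable M"
    and "integrable M (\<lambda>\<omega>. (U \<omega>)\<^sup>2)" "integrable M (\<lambda>\<omega>. (V \<omega>)\<^sup>2)"
  shows "integrable M (\<lambda>\<omega>. U \<omega> * V \<omega>)"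
proof (rule Bochner_Integration.integrable_bound)
  show "integrable M (\<lambda>\<omega>. (U \<omega>)\<^sup>2 + (V \<omega>)\<^sup>2)"
    using assms by auto
  have "\<bar>u\<bar> * \<bar>v\<bar> \<le> u\<^sup>2 + v\<^sup>2" for u v :: real
    using sum_squares_bound[of "\<bar>u\<bar>" "\<bar>v\<bar>"] mult_nonneg_nonneg[OF abs_ge_zero[of u] abs_ge_zero[of v]]
    unfolding power2_abs mult.assoc by linarith
  then show "AE \<omega> in M. norm (U \<omega> * V \<omega>) \<le> norm ((U \<omega>)\<^sup>2 + (V \<omega>)\<^sup>2)"
    by (simp add: abs_mult)
qed measurable

end

section \<open>Covariate moments and the Gram matrix in the randomized experiment\<close>

context car_setting
begin

lemma covariates_measurable [measurable]: "rvec {..<p+q} (x i) \<in> M \<rightarrow>\<^sub>M borel_vec {..<p+q}"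
  using x_indep by (simp add: indep_vars_def)

lemma covariate_measurable: "j < p + q \<Longrightarrow> x i j \<in> borel_measurable M"
  using measurable_compose[OF covariates_measurable measurable_component_singleton, of j i]
  by simp

lemma X_measurable: "j < p + q \<Longrightarrow> X j \<in> borel_measurable M"
  by (rule borel_measurable_integrable[OF X_integrable])

lemma X_vec_measurable [measurable]: "rvec {..<p+q} X \<in> M \<rightarrow>\<^sub>M borel_vec {..<p+q}"
  using X_measurable by (intro measurable_restrict) auto

lemma error_measurable [measurable]: "\<epsilon> i \<in> borel_measurable M"
  by (rule borel_measurable_integrable[OF \<epsilon>_integrable])

lemma component_measurable: "j < p + q \<Longrightarrow> (\<lambda>z. z j) \<in> borel_vec {..<p+q} \<rightarrow>\<^sub>M borel"
  by (rule measurable_component_singleton) simp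

text \<open>Both sides are integrals of \<open>f\<close> against the same law. The transfer concerns
  functions of the whole vector because products of two covariates occur.\<close>

lemma
  fixes f :: "(nat \<Rightarrow> real) \<Rightarrow> real"
  assumes [measurable]: "f \<in> borel_vec {..<p+q} \<rightarrow>\<^sub>M borel"
  shows integrable_covariates_iff:
      "integrable M (\<lambda>\<omega>. f (rvec {..<p+q} (x i) \<omega>)) \<longleftrightarrow> integrable M (\<lambda>\<omega>. f (rvec {..<p+q} X \<omega>))"
    and expectation_covariates:
      "expectation (\<lambda>\<omega>. f (rvec {..<p+q} (x i) \<omega>)) = expectation (\<lambda>\<omega>. f (rvec {..<p+q} X \<omega>))"
proof -
  show "integrable M (\<lambda>\<omega>. f (rvec {..<p+q} (x i) \<omega>)) \<longleftrightarrow> integrable M (\<lambda>\<omega>. f (rvec {..<p+q} X \<omega>))"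
    using integrable_distr_eq[OF covariates_measurable assms] integrable_distr_eq[OF X_vec_measurable assms]
    unfolding x_law by blast
  show "expectation (\<lambda>\<omega>. f (rvec {..<p+q} (x i) \<omega>)) = expectation (\<lambda>\<omega>. f (rvec {..<p+q} X \<omega>))"
    using integral_distr[OF covariates_measurable assms] integral_distr[OF X_vec_measurable assms]
    unfolding x_law by metis
qed

text \<open>Distinct units are independent and the summands are centred, hence orthogonal. The
  function \<open>f\<close> will be a coordinate, a product of two coordinates, or a centred
  truncated square.\<close>

lemma covariates_sum_bounded:
  assumes f [measurable]: "f \<in> borel_vec {..<p+q} \<rightarrow>\<^sub>M borel"
    and sq: "integrable M (\<lambda>\<omega>. (f (rvec {..<p+q} X \<omega>))\<^sup>2)"
    and mean: "expectation (\<lambda>\<omega>. f (rvec {..<p+q} X \<omega>)) = 0"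
  shows "bounded_in_prob (\<lambda>n \<omega>. (\<Sum>i<n. f (rvec {..<p+q} (x i) \<omega>)) / sqrt (real n))"
proof (rule bounded_in_prob_orthogonal)
  fix n i j :: nat assume "i \<noteq> j"
  have "integrable M (\<lambda>\<omega>. f (rvec {..<p+q} X \<omega>))"
    by (rule square_integrable_imp_integrable[OF _ sq]) measurable
  then have "integrable M (\<lambda>\<omega>. f (rvec {..<p+q} (x i) \<omega>))" for i
    by (simp only: integrable_covariates_iff[OF f])
  moreover have "expectation (\<lambda>\<omega>. f (rvec {..<p+q} (x i) \<omega>)) = 0" for i
    using mean by (simp only: expectation_covariates[OF f])
  moreover have "indep_vars (\<lambda>_. borel) (\<lambda>i \<omega>. f (rvec {..<p+q} (x i) \<omega>)) UNIV"
    by (rule indep_vars_compose2[OF x_indep]) measurable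
  ultimately show "integrable M (\<lambda>\<omega>. f (rvec {..<p+q} (x i) \<omega>) * f (rvec {..<p+q} (x j) \<omega>)) \<and>
      expectation (\<lambda>\<omega>. f (rvec {..<p+q} (x i) \<omega>) * f (rvec {..<p+q} (x j) \<omega>)) = 0"
    using indep_vars_mult[of "\<lambda>i \<omega>. f (rvec {..<p+q} (x i) \<omega>)" UNIV i j] \<open>i \<noteq> j\<close>
    by (simp only: UNIV_I mult_zero_left simp_thms)
next
  fix n i :: nat
  have f2: "(\<lambda>z. (f z)\<^sup>2) \<in> borel_vec {..<p+q} \<rightarrow>\<^sub>M borel" by measurable
  show "integrable M (\<lambda>\<omega>. (f (rvec {..<p+q} (x i) \<omega>))\<^sup>2)"
    using sq by (simp only: integrable_covariates_iff[OF f2])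
  show "expectation (\<lambda>\<omega>. (f (rvec {..<p+q} (x i) \<omega>))\<^sup>2) \<le> expectation (\<lambda>\<omega>. (f (rvec {..<p+q} X \<omega>))\<^sup>2)"
    by (simp only: expectation_covariates[OF f2] order_refl)
qed measurable

text \<open>Covariate \<open>j\<close> has index \<open>j + 2\<close>. Indices from
  \<open>p + 2\<close> on reach the omitted covariates, whose cross moments with the included
  regressors enter the scores.\<close>

definition regressor :: "nat \<Rightarrow> nat \<Rightarrow> nat \<Rightarrow> 'a \<Rightarrow> real" where
  "regressor n k i \<omega> = (if k = 0 then 2 * T n i \<omega> - 1 else if k = 1 then 1 else x i (k - 2) \<omega>)"

lemma regressor_simps [simp]:
  "regressor n 0 i \<omega> = 2 * T n i \<omega> - 1" "regressor n (Suc 0) i \<omega> = 1"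
  "regressor n (Suc (Suc j)) i \<omega> = x i j \<omega>"
  by (simp_all add: regressor_def)

lemma regressor_measurable:
  "i < n \<Longrightarrow> k < p + q + 2 \<Longrightarrow> regressor n k i \<in> borel_measurable M"
  using assignment_measurable[of i n] covariate_measurable[of "k - 2" i]
  by (cases "k < 2") (auto simp: regressor_def[abs_def] less_2_cases_iff)

lemma regressor_cases [consumes 1, case_names treatment const covariate]:
  assumes "k < m + 2"
  obtains "k = 0" | "k = 1" | j where "j < m" "k = Suc (Suc j)"
proof -
  have "k = 0 \<or> k = 1 \<or> (\<exists>j<m. k = Suc (Suc j))" using assms by presburger
  with that show thesis by blast
qed

lemma treatment_square: "i < n \<Longrightarrow> \<omega> \<in> space M \<Longrightarrow> (2 * T n i \<omega> - 1)\<^sup>2 = 1"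
  using assignment_01[of i n \<omega>] by auto

lemma regressor_square:
  assumes "i < n" "k < p + q + 2"
  shows "integrable M (\<lambda>\<omega>. (regressor n k i \<omega>)\<^sup>2)"
    and "expectation (\<lambda>\<omega>. (regressor n k i \<omega>)\<^sup>2) = (if k < 2 then 1 else expectation (\<lambda>\<omega>. (X (k - 2) \<omega>)\<^sup>2))"
proof -
  have "integrable M (\<lambda>\<omega>. (regressor n k i \<omega>)\<^sup>2) \<and>
      expectation (\<lambda>\<omega>. (regressor n k i \<omega>)\<^sup>2) = (if k < 2 then 1 else expectation (\<lambda>\<omega>. (X (k - 2) \<omega>)\<^sup>2))"
    using assms(2)
  proof (cases k rule: regressor_cases)
    case treatment
    have "integrable M (\<lambda>\<omega>. (2 * T n i \<omega> - 1)\<^sup>2) \<longleftrightarrow> integrable M (\<lambda>\<omega>. 1 :: real)"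
      using treatment_square[OF assms(1)] by (intro Bochner_Integration.integrable_cong) auto
    moreover have "expectation (\<lambda>\<omega>. (2 * T n i \<omega> - 1)\<^sup>2) = expectation (\<lambda>\<omega>. 1 :: real)"
      using treatment_square[OF assms(1)] by (intro Bochner_Integration.integral_cong) auto
    ultimately show ?thesis
      using treatment by (simp add: prob_space)
  next
    case const
    then show ?thesis by (simp add: prob_space)
  next
    case (covariate j)
    have f: "(\<lambda>z. (z j)\<^sup>2) \<in> borel_vec {..<p+q} \<rightarrow>\<^sub>M borel"
      using component_measurable[OF covariate(1)] by measurable
    show ?thesis
      using integrable_covariates_iff[OF f, of i] expectation_covariates[OF f, of i]
        X_sq_integrable[OF covariate(1)] covariate by simp
  qed
  then show "integrable M (\<lambda>\<omega>. (regressor n k i \<omega>)\<^sup>2)"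
    and "expectation (\<lambda>\<omega>. (regressor n k i \<omega>)\<^sup>2) = (if k < 2 then 1 else expectation (\<lambda>\<omega>. (X (k - 2) \<omega>)\<^sup>2))"
    by auto
qed

text \<open>The sign paired with a covariate is covered by \<open>balance\<close>, the other pairs
  by centred sums over independent units. The condition \<open>l \<noteq> 1\<close> excludes the
  sign paired with the constant, for which global balance gives o(n) and no rate of order
  \<open>sqrt n\<close>.\<close>

lemma cross_moment_bounded:
  assumes balance: "\<And>j. j < p + q \<Longrightarrow> bounded_in_prob (\<lambda>n \<omega>. (\<Sum>i<n. (2 * T n i \<omega> - 1) * x i j \<omega>) / sqrt (real n))"
    and k: "k < l" "l < p + q + 2" "l \<noteq> 1"
  shows "bounded_in_prob (\<lambda>n \<omega>. (\<Sum>i<n. regressor n k i \<omega> * regressor n l i \<omega>) / sqrt (real n))"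
proof -
  have "l - 2 < p + q" "l = Suc (Suc (l - 2))" "k < p + q + 2" using k by auto
  then obtain j where l: "j < p + q" "l = Suc (Suc j)" by blast
  note [measurable] = component_measurable[OF l(1)]
  from \<open>k < p + q + 2\<close> show ?thesis
  proof (cases k rule: regressor_cases)
    case treatment
    then show ?thesis using balance[OF l(1)] l by simp
  next
    case const
    have "bounded_in_prob (\<lambda>n \<omega>. (\<Sum>i<n. rvec {..<p+q} (x i) \<omega> j) / sqrt (real n))"
      using X_mean[OF l(1)] X_sq_integrable[OF l(1)] l(1)
      by (intro covariates_sum_bounded) auto
    then show ?thesis using const l by simp
  next
    case (covariate j')
    note [measurable] = component_measurable[OF covariate(1)]
    have "j \<noteq> j'" using k(1) l covariate by auto
    \<comment> \<open>Independence of the squares gives the product a second moment without fourth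
      moments of the factors.\<close>
    have ind: "indep_vars (\<lambda>_. borel) (\<lambda>j \<omega>. (X j \<omega>)\<^sup>2) {..<p+q}"
      using X_indep by (rule indep_vars_compose2) measurable
    have "expectation (\<lambda>\<omega>. X j' \<omega> * X j \<omega>) = 0"
      using indep_vars_mult(2)[OF X_indep, of j' j] \<open>j \<noteq> j'\<close> covariate(1) l(1)
      by (simp add: X_integrable X_mean)
    moreover have "integrable M (\<lambda>\<omega>. (X j' \<omega> * X j \<omega>)\<^sup>2)"
      using indep_vars_mult(1)[OF ind, of j' j] \<open>j \<noteq> j'\<close> covariate(1) l(1)
      by (simp add: X_sq_integrable power_mult_distrib)
    ultimately have "bounded_in_prob (\<lambda>n \<omega>. (\<Sum>i<n. rvec {..<p+q} (x i) \<omega> j' * rvec {..<p+q} (x i) \<omega> j) / sqrt (real n))"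
      using l(1) covariate(1) by (intro covariates_sum_bounded[where f="\<lambda>z. z j' * z j"]) auto
    then show ?thesis using covariate l by simp
  qed
qed

definition gram :: "nat \<Rightarrow> 'a \<Rightarrow> nat \<Rightarrow> nat \<Rightarrow> real" where
  "gram n \<omega> k l = (\<Sum>i<n. regressor n k i \<omega> * regressor n l i \<omega>) / real n"

lemma gram_commute: "gram n \<omega> k l = gram n \<omega> l k"
  by (simp add: gram_def mult.commute)

lemma gram_measurable:
  "k < p + q + 2 \<Longrightarrow> l < p + q + 2 \<Longrightarrow> (\<lambda>\<omega>. gram n \<omega> k l) \<in> borel_measurable M"
  unfolding gram_def
  by (intro borel_measurable_divide borel_measurable_sum borel_measurable_times) (auto intro: regressor_measurable)

text \<open>The sign paired with the constant is \<open>global\<close> itself; any other cross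
  moment is of order \<open>sqrt n\<close> in probability, and dividing by \<open>n\<close> leaves a
  factor that vanishes.\<close>

lemma gram_offdiag_null:
  assumes balance: "\<And>j. j < p + q \<Longrightarrow> bounded_in_prob (\<lambda>n \<omega>. (\<Sum>i<n. (2 * T n i \<omega> - 1) * x i j \<omega>) / sqrt (real n))"
    and global: "tendsto_in_prob M (\<lambda>n \<omega>. (\<Sum>i<n. 2 * T n i \<omega> - 1) / real n) 0"
    and kl: "k < p + q + 2" "l < p + q + 2" "k \<noteq> l"
  shows "null_in_prob (\<lambda>n \<omega>. gram n \<omega> k l)"
  using kl
proof (induction k l rule: linorder_wlog)
  case (le k l)
  show ?case
  proof (cases "l = 1")
    case True
    then have "k = 0" using le by auto
    then show ?thesis
      using global gram_measurable[OF le(2,3)] True by (simp add: null_in_prob_def gram_def)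
  next
    case False
    have "bounded_in_prob (\<lambda>n \<omega>. (\<Sum>i<n. regressor n k i \<omega> * regressor n l i \<omega>) / sqrt (real n))"
      using balance le False by (intro cross_moment_bounded) auto
    from bounded_in_prob_divide_sqrt[OF this] show ?thesis
      by (simp add: gram_def flip: real_sqrt_mult)
  qed
qed (simp add: gram_commute)

text \<open>A vanishing truncated moment would force the covariate to be 0 almost surely,
  contradicting its positive variance. The truncated moment supplies the lower bound for the
  diagonal of the Gram matrix.\<close>

lemma truncated_second_moment_pos:
  assumes j: "j < p + q"
  shows "expectation (\<lambda>\<omega>. min ((X j \<omega>)\<^sup>2) 1) > 0"
proof (rule ccontr)
  note [measurable] = X_measurable[OF j]
  have int: "integrable M (\<lambda>\<omega>. min ((X j \<omega>)\<^sup>2) 1)"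
    by (rule integrable_const_bound[of _ 1]) (auto simp: min_def)
  assume "\<not> ?thesis"
  then have "expectation (\<lambda>\<omega>. min ((X j \<omega>)\<^sup>2) 1) = 0"
    by (intro antisym integral_nonneg_AE) auto
  then have "AE \<omega> in M. min ((X j \<omega>)\<^sup>2) 1 = 0"
    using int by (subst (asm) integral_nonneg_eq_0_iff_AE) auto
  then have "AE \<omega> in M. (X j \<omega>)\<^sup>2 = 0"
    by eventually_elim (auto simp: min_def split: if_splits)
  then have "expectation (\<lambda>\<omega>. (X j \<omega>)\<^sup>2) = expectation (\<lambda>\<omega>. 0 :: real)"
    by (intro integral_cong_AE) auto
  with X_var[OF j] X_mean[OF j] show False by simp
qed

text \<open>For a covariate, the average of squares is at least the average of the truncated
  squares, and the latter concentrates around its positive mean. The conjunct \<open>n > 0\<close>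
  discards the empty experiment, where division by 0 makes the Gram entry 0.\<close>

lemma gram_diag_bounded_below:
  assumes k: "k < p + q + 2"
  obtains h where "h > 0" "(\<lambda>n. prob {\<omega>\<in>space M. n > 0 \<and> gram n \<omega> k k < h}) \<longlonglongrightarrow> 0"
  using k
proof (cases k rule: regressor_cases)
  case treatment
  have "gram n \<omega> 0 0 = 1" if "n > 0" "\<omega> \<in> space M" for n \<omega>
    using treatment_square[OF _ that(2)] that(1) by (simp add: gram_def power2_eq_square)
  then have "{\<omega>\<in>space M. n > 0 \<and> gram n \<omega> k k < 1} = {}" for n
    using treatment by auto
  then show ?thesis by (intro that[of 1]) (simp_all only: measure_empty tendsto_const zero_less_one)
next
  case const
  then have "{\<omega>\<in>space M. n > 0 \<and> gram n \<omega> k k < 1} = {}" for n by (auto simp: gram_def)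
  then show ?thesis by (intro that[of 1]) (simp_all only: measure_empty tendsto_const zero_less_one)
next
  case (covariate j)
  note [measurable] = X_measurable[OF covariate(1)] component_measurable[OF covariate(1)]
    covariate_measurable[OF covariate(1)]
  define c where "c = expectation (\<lambda>\<omega>. min ((X j \<omega>)\<^sup>2) 1)"
  have c: "c > 0" using truncated_second_moment_pos[OF covariate(1)] by (simp add: c_def)
  \<comment> \<open>Centring at \<open>c\<close> makes the mean 0, and truncation makes
    \<open>f\<close> bounded, hence square-integrable.\<close>
  define f :: "(nat \<Rightarrow> real) \<Rightarrow> real" where "f z = min ((z j)\<^sup>2) 1 - c" for z
  have int: "integrable M (\<lambda>\<omega>. min ((X j \<omega>)\<^sup>2) 1)"
    by (rule integrable_const_bound[of _ 1]) (auto simp: min_def)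
  have "bounded_in_prob (\<lambda>n \<omega>. (\<Sum>i<n. f (rvec {..<p+q} (x i) \<omega>)) / sqrt (real n))"
  proof (rule covariates_sum_bounded)
    show "f \<in> borel_vec {..<p+q} \<rightarrow>\<^sub>M borel" unfolding f_def by measurable
    then have "(\<lambda>\<omega>. f (rvec {..<p+q} X \<omega>)) \<in> borel_measurable M"
      by (rule measurable_compose[OF X_vec_measurable])
    moreover have "(f z)\<^sup>2 \<le> (1 + \<bar>c\<bar>)\<^sup>2" for z
    proof -
      have "0 \<le> (z j)\<^sup>2" by simp
      then have "\<bar>f z\<bar> \<le> 1 + \<bar>c\<bar>" unfolding f_def by linarith
      then show ?thesis using power_mono[of "\<bar>f z\<bar>" "1 + \<bar>c\<bar>" 2] by simp
    qed
    ultimately show "integrable M (\<lambda>\<omega>. (f (rvec {..<p+q} X \<omega>))\<^sup>2)"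
      by (intro integrable_const_bound[of _ "(1 + \<bar>c\<bar>)\<^sup>2"]) auto
    show "expectation (\<lambda>\<omega>. f (rvec {..<p+q} X \<omega>)) = 0"
      using covariate(1) int by (simp add: f_def prob_space c_def)
  qed
  from null_in_probD[OF bounded_in_prob_divide_sqrt[OF this], of "c / 3"]
  have lim: "(\<lambda>n. prob {\<omega>\<in>space M. \<bar>(\<Sum>i<n. f (rvec {..<p+q} (x i) \<omega>)) / real n\<bar> > c / 3}) \<longlonglongrightarrow> 0"
    using c by (simp flip: real_sqrt_mult)
  \<comment> \<open>A Gram entry below \<open>c / 2\<close> forces the centred average below
    \<open>- (c / 2)\<close>, which exceeds the threshold \<open>c / 3\<close> in absolute
    value.\<close>
  have "prob {\<omega>\<in>space M. n > 0 \<and> gram n \<omega> k k < c / 2}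
      \<le> prob {\<omega>\<in>space M. \<bar>(\<Sum>i<n. f (rvec {..<p+q} (x i) \<omega>)) / real n\<bar> > c / 3}" for n
  proof (rule finite_measure_mono)
    show "{\<omega>\<in>space M. n > 0 \<and> gram n \<omega> k k < c / 2}
      \<subseteq> {\<omega>\<in>space M. \<bar>(\<Sum>i<n. f (rvec {..<p+q} (x i) \<omega>)) / real n\<bar> > c / 3}"
    proof clarify
      fix \<omega> assume n: "n > 0" and "gram n \<omega> k k < c / 2"
      then have "(\<Sum>i<n. (x i j \<omega>)\<^sup>2) < c / 2 * real n"
        using covariate by (simp add: gram_def power2_eq_square field_simps)
      moreover have "(\<Sum>i<n. f (rvec {..<p+q} (x i) \<omega>)) \<le> (\<Sum>i<n. (x i j \<omega>)\<^sup>2 - c)"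
        using covariate(1) by (intro sum_mono) (auto simp: f_def)
      moreover have "(\<Sum>i<n. (x i j \<omega>)\<^sup>2 - c) = (\<Sum>i<n. (x i j \<omega>)\<^sup>2) - (c / 2 * real n + c / 2 * real n)"
        by (simp add: sum_subtractf)
      ultimately have "(\<Sum>i<n. f (rvec {..<p+q} (x i) \<omega>)) < - (c / 2 * real n)"
        by linarith
      then have "(\<Sum>i<n. f (rvec {..<p+q} (x i) \<omega>)) / real n < - (c / 2)"
        using n by (simp add: pos_divide_less_eq)
      then show "\<bar>(\<Sum>i<n. f (rvec {..<p+q} (x i) \<omega>)) / real n\<bar> > c / 3" using c by linarith
    qed
    have "f \<in> borel_vec {..<p+q} \<rightarrow>\<^sub>M borel" unfolding f_def by measurable
    note [measurable] = measurable_compose[OF covariates_measurable this]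
    show "{\<omega>\<in>space M. \<bar>(\<Sum>i<n. f (rvec {..<p+q} (x i) \<omega>)) / real n\<bar> > c / 3} \<in> events" by measurable
  qed
  then have "(\<lambda>n. prob {\<omega>\<in>space M. n > 0 \<and> gram n \<omega> k k < c / 2}) \<longlonglongrightarrow> 0"
    by (intro tendsto_sandwich[OF always_eventually always_eventually tendsto_const lim]) auto
  then show ?thesis using c by (intro that[of "c / 2"]) auto
qed

section \<open>The design as one random element, independent of the errors\<close>

abbreviation design_space :: "nat \<Rightarrow> ((nat \<Rightarrow> real) \<times> (nat \<times> nat \<Rightarrow> real)) measure" where
  "design_space n \<equiv> borel_vec {..<n} \<Otimes>\<^sub>M borel_vec ({..<n} \<times> {..<p+q})"

abbreviation design :: "nat \<Rightarrow> 'a \<Rightarrow> (nat \<Rightarrow> real) \<times> (nat \<times> nat \<Rightarrow> real)" where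
  "design n \<equiv> \<lambda>\<omega>. (rvec {..<n} (T n) \<omega>, rvec ({..<n} \<times> {..<p+q}) (\<lambda>(i, j). x i j) \<omega>)"

lemma design_measurable: "design n \<in> M \<rightarrow>\<^sub>M design_space n"
  using design_indep_errors[of n] by (simp add: indep_rv_def)

lemma indep_design_errors:
  assumes "F \<in> design_space n \<rightarrow>\<^sub>M L" "G \<in> borel_vec {..<n} \<rightarrow>\<^sub>M K"
  shows "indep_var L (\<lambda>\<omega>. F (design n \<omega>)) K (\<lambda>\<omega>. G (rvec {..<n} \<epsilon> \<omega>))"
  by (rule indep_rv_compose[OF design_indep_errors assms])

text \<open>The regressors as functions of a value of the design, the form in which independence of
  design and errors applies. Outside the index sets the restricted functions carry no information,
  hence the bounds on \<open>i\<close> and \<open>k\<close> in the lemmas on it.\<close>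

definition regressor_of :: "nat \<Rightarrow> nat \<Rightarrow> (nat \<Rightarrow> real) \<times> (nat \<times> nat \<Rightarrow> real) \<Rightarrow> real" where
  "regressor_of k i z = (if k = 0 then 2 * fst z i - 1 else if k = 1 then 1 else snd z (i, k - 2))"

lemma regressor_of_design:
  "i < n \<Longrightarrow> k < p + q + 2 \<Longrightarrow> regressor_of k i (design n \<omega>) = regressor n k i \<omega>"
  by (auto simp: regressor_of_def regressor_def)

lemma regressor_of_measurable:
  assumes "i < n" "k < p + q + 2"
  shows "regressor_of k i \<in> design_space n \<rightarrow>\<^sub>M borel"
proof -
  have [measurable]: "(\<lambda>z. fst z i) \<in> design_space n \<rightarrow>\<^sub>M borel"
    using assms(1) by (intro measurable_compose[OF measurable_fst measurable_component_singleton]) simp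
  have "(\<lambda>z. snd z (i, k - 2)) \<in> design_space n \<rightarrow>\<^sub>M borel" if "\<not> k < 2"
    using assms that by (intro measurable_compose[OF measurable_snd measurable_component_singleton]) auto
  then show ?thesis
    unfolding regressor_of_def[abs_def] by (cases "k < 2") (auto simp: less_2_cases_iff)
qed

lemma errors_orthogonal:
  assumes "i \<noteq> j"
  shows "integrable M (\<lambda>\<omega>. \<epsilon> i \<omega> * \<epsilon> j \<omega>)" "expectation (\<lambda>\<omega>. \<epsilon> i \<omega> * \<epsilon> j \<omega>) = 0"
  using indep_vars_mult[OF \<epsilon>_indep, of i j] assms \<epsilon>_integrable \<epsilon>_mean by auto

text \<open>Products of regressors are functions of the design, so the expectation of a cross term
  factorizes and the error factor has mean 0. Dependence between the assignments of different units
  does no harm.\<close>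

lemma regressor_error_bounded:
  assumes k: "k < p + q + 2"
  shows "bounded_in_prob (\<lambda>n \<omega>. (\<Sum>i<n. regressor n k i \<omega> * \<epsilon> i \<omega>) / sqrt (real n))"
proof (rule bounded_in_prob_orthogonal)
  fix n i j :: nat assume ij: "i < n" "j < n" "i \<noteq> j"
  note [measurable] = regressor_of_measurable[OF ij(1) k] regressor_of_measurable[OF ij(2) k]
  have [measurable]: "(\<lambda>e. e i) \<in> borel_vec {..<n} \<rightarrow>\<^sub>M borel" "(\<lambda>e. e j) \<in> borel_vec {..<n} \<rightarrow>\<^sub>M borel"
    using ij by (auto intro!: measurable_component_singleton)
  have "(\<lambda>z. regressor_of k i z * regressor_of k j z) \<in> design_space n \<rightarrow>\<^sub>M borel" by measurable
  moreover have "(\<lambda>e. e i * e j) \<in> borel_vec {..<n} \<rightarrow>\<^sub>M (borel :: real measure)" by measurable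
  ultimately have "indep_var borel (\<lambda>\<omega>. regressor_of k i (design n \<omega>) * regressor_of k j (design n \<omega>))
      borel (\<lambda>\<omega>. rvec {..<n} \<epsilon> \<omega> i * rvec {..<n} \<epsilon> \<omega> j)"
    by (rule indep_design_errors)
  then have ind: "indep_var borel (\<lambda>\<omega>. regressor n k i \<omega> * regressor n k j \<omega>) borel (\<lambda>\<omega>. \<epsilon> i \<omega> * \<epsilon> j \<omega>)"
    using ij k by (simp add: regressor_of_design)
  have int: "integrable M (\<lambda>\<omega>. regressor n k i \<omega> * regressor n k j \<omega>)"
    using ij k by (intro integrable_mult_square regressor_measurable regressor_square) auto
  have eq: "regressor n k i \<omega> * \<epsilon> i \<omega> * (regressor n k j \<omega> * \<epsilon> j \<omega>) =
      regressor n k i \<omega> * regressor n k j \<omega> * (\<epsilon> i \<omega> * \<epsilon> j \<omega>)" for \<omega>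
    by simp
  show "integrable M (\<lambda>\<omega>. regressor n k i \<omega> * \<epsilon> i \<omega> * (regressor n k j \<omega> * \<epsilon> j \<omega>)) \<and>
      expectation (\<lambda>\<omega>. regressor n k i \<omega> * \<epsilon> i \<omega> * (regressor n k j \<omega> * \<epsilon> j \<omega>)) = 0"
    unfolding eq
    using indep_var_integrable[OF ind int errors_orthogonal(1)[OF ij(3)]]
      indep_var_lebesgue_integral[OF ind int errors_orthogonal(1)[OF ij(3)]] errors_orthogonal(2)[OF ij(3)]
    by simp
next
  fix n i :: nat assume i: "i < n"
  show "(\<lambda>\<omega>. regressor n k i \<omega> * \<epsilon> i \<omega>) \<in> borel_measurable M"
    using regressor_measurable[OF i k] by simp
  note [measurable] = regressor_of_measurable[OF i k]
  have [measurable]: "(\<lambda>e. e i) \<in> borel_vec {..<n} \<rightarrow>\<^sub>M borel"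
    using i by (auto intro!: measurable_component_singleton)
  have "(\<lambda>z. (regressor_of k i z)\<^sup>2) \<in> design_space n \<rightarrow>\<^sub>M borel" by measurable
  moreover have "(\<lambda>e. (e i)\<^sup>2) \<in> borel_vec {..<n} \<rightarrow>\<^sub>M (borel :: real measure)" by measurable
  ultimately have "indep_var borel (\<lambda>\<omega>. (regressor_of k i (design n \<omega>))\<^sup>2) borel (\<lambda>\<omega>. (rvec {..<n} \<epsilon> \<omega> i)\<^sup>2)"
    by (rule indep_design_errors)
  then have ind: "indep_var borel (\<lambda>\<omega>. (regressor n k i \<omega>)\<^sup>2) borel (\<lambda>\<omega>. (\<epsilon> i \<omega>)\<^sup>2)"
    using i k by (simp add: regressor_of_design)
  show "integrable M (\<lambda>\<omega>. (regressor n k i \<omega> * \<epsilon> i \<omega>)\<^sup>2)"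
    unfolding power_mult_distrib
    by (rule indep_var_integrable[OF ind regressor_square(1)[OF i k] \<epsilon>_sq_integrable])
  have "expectation (\<lambda>\<omega>. (\<epsilon> i \<omega>)\<^sup>2) = \<sigma>\<^sup>2" using \<epsilon>_var[of i] \<epsilon>_mean[of i] by simp
  then show "expectation (\<lambda>\<omega>. (regressor n k i \<omega> * \<epsilon> i \<omega>)\<^sup>2)
      \<le> (if k < 2 then 1 else expectation (\<lambda>\<omega>. (X (k - 2) \<omega>)\<^sup>2)) * \<sigma>\<^sup>2"
    unfolding power_mult_distrib
    using indep_var_lebesgue_integral[OF ind regressor_square(1)[OF i k] \<epsilon>_sq_integrable]
      regressor_square(2)[OF i k] by simp
qed

section \<open>Scores of the omitted covariates and errors\<close>

definition omitted :: "(nat \<Rightarrow> real) \<Rightarrow> nat \<Rightarrow> 'a \<Rightarrow> real" where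
  "omitted \<beta> i \<omega> = (\<Sum>j\<in>{p..<p+q}. \<beta> j * x i j \<omega>) + \<epsilon> i \<omega>"

definition score :: "(nat \<Rightarrow> real) \<Rightarrow> nat \<Rightarrow> nat \<Rightarrow> 'a \<Rightarrow> real" where
  "score \<beta> k n \<omega> = (\<Sum>i<n. regressor n k i \<omega> * omitted \<beta> i \<omega>) / sqrt (real n)"

lemma score_eq:
  "score \<beta> k n \<omega> = (\<Sum>j\<in>{p..<p+q}. \<beta> j * ((\<Sum>i<n. regressor n k i \<omega> * x i j \<omega>) / sqrt (real n)))
    + (\<Sum>i<n. regressor n k i \<omega> * \<epsilon> i \<omega>) / sqrt (real n)"
proof -
  have "(\<Sum>i<n. regressor n k i \<omega> * omitted \<beta> i \<omega>) =
      (\<Sum>i<n. \<Sum>j\<in>{p..<p+q}. \<beta> j * (regressor n k i \<omega> * x i j \<omega>)) + (\<Sum>i<n. regressor n k i \<omega> * \<epsilon> i \<omega>)"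
    by (simp add: omitted_def distrib_left sum.distrib sum_distrib_left mult_ac)
  also have "(\<Sum>i<n. \<Sum>j\<in>{p..<p+q}. \<beta> j * (regressor n k i \<omega> * x i j \<omega>)) =
      (\<Sum>j\<in>{p..<p+q}. \<beta> j * (\<Sum>i<n. regressor n k i \<omega> * x i j \<omega>))"
    by (subst sum.swap) (simp add: sum_distrib_left)
  finally show ?thesis by (simp add: score_def add_divide_distrib sum_divide_distrib[of _ "{p..<p+q}"])
qed

text \<open>An omitted covariate has \<open>j \<ge> p\<close>, so its index
  \<open>Suc (Suc j)\<close> exceeds \<open>k\<close>: only off-diagonal cross moments appear, and
  these have order \<open>sqrt n\<close>.\<close>

lemma score_bounded:
  assumes balance: "\<And>j. j < p + q \<Longrightarrow> bounded_in_prob (\<lambda>n \<omega>. (\<Sum>i<n. (2 * T n i \<omega> - 1) * x i j \<omega>) / sqrt (real n))"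
    and k: "k < p + 2"
  shows "bounded_in_prob (score \<beta> k)"
proof -
  have "bounded_in_prob (\<lambda>n \<omega>. (\<Sum>i<n. regressor n k i \<omega> * x i j \<omega>) / sqrt (real n))"
    if "j \<in> {p..<p+q}" for j
    using cross_moment_bounded[OF balance, of k "Suc (Suc j)"] that k by simp
  then have "bounded_in_prob (\<lambda>n \<omega>. (\<Sum>j\<in>{p..<p+q}. \<beta> j * ((\<Sum>i<n. regressor n k i \<omega> * x i j \<omega>) / sqrt (real n)))
    + (\<Sum>i<n. regressor n k i \<omega> * \<epsilon> i \<omega>) / sqrt (real n))"
    using k by (intro bounded_in_prob_add bounded_in_prob_sum bounded_in_prob_cmult regressor_error_bounded) auto
  then show ?thesis by (simp add: score_eq[abs_def])
qed

section \<open>Limit of the characteristic function of the treatment score\<close>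

lemma char_signed_errors:
  shows "(CLINT \<omega>|M. iexp (\<Sum>i<n. c i * \<epsilon> i \<omega>)) = (\<Prod>i<n. char (distr M borel (\<epsilon> 0)) (c i))"
proof -
  have "indep_vars (\<lambda>_. borel) (\<lambda>i \<omega>. c i * \<epsilon> i \<omega>) UNIV"
    by (rule indep_vars_compose2[OF \<epsilon>_indep, where Y="\<lambda>i e. c i * e"]) simp
  then have "indep_vars (\<lambda>_. borel) (\<lambda>i \<omega>. c i * \<epsilon> i \<omega>) {..<n}" by (rule indep_vars_subset) simp
  from char_distr_sum[OF this, of 1]
  have "(CLINT \<omega>|M. iexp (\<Sum>i<n. c i * \<epsilon> i \<omega>)) = (\<Prod>i<n. char (distr M borel (\<lambda>\<omega>. c i * \<epsilon> i \<omega>)) 1)"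
    by (simp add: char_def integral_distr)
  moreover have "char (distr M borel (\<lambda>\<omega>. c i * \<epsilon> i \<omega>)) 1 = char (distr M borel (\<epsilon> i)) (c i)" for i
    by (simp add: char_def integral_distr)
  then have "char (distr M borel (\<lambda>\<omega>. c i * \<epsilon> i \<omega>)) 1 = char (distr M borel (\<epsilon> 0)) (c i)" for i
    by (simp only: \<epsilon>_law[of i])
  ultimately show ?thesis by (simp only:)
qed

text \<open>Given the design, the errors enter only through the signs \<open>2 * T n i - 1\<close>; decomposing the
  expectation over the finitely many sign patterns replaces conditioning on the design.\<close>

lemma char_design_errors:
  fixes H :: "(nat \<Rightarrow> real) \<times> (nat \<times> nat \<Rightarrow> real) \<Rightarrow> complex"
  assumes H: "H \<in> design_space n \<rightarrow>\<^sub>M borel" "\<And>z. cmod (H z) \<le> 1" and w: "cmod w \<le> 1"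
    and close: "\<And>a. \<bar>a\<bar> = 1 \<Longrightarrow> cmod (char (distr M borel (\<epsilon> 0)) (s * a / sqrt (real n)) - w) \<le> \<delta>"
  shows "cmod ((CLINT \<omega>|M. H (design n \<omega>) * iexp (\<Sum>i<n. s * (2 * T n i \<omega> - 1) / sqrt (real n) * \<epsilon> i \<omega>))
    - (CLINT \<omega>|M. H (design n \<omega>)) * w ^ n) \<le> real n * \<delta>"
proof -
  let ?\<phi> = "char (distr M borel (\<epsilon> 0))"
  interpret law: real_distribution "distr M borel (\<epsilon> 0)" by (rule real_distribution_distr) simp
  \<comment> \<open>All sign patterns of the \<open>n\<close> units; extensionality of the members
    of \<open>PiE\<close> makes the pattern of a realization unique.\<close>
  define P :: "(nat \<Rightarrow> real) set" where "P = PiE {..<n} (\<lambda>_. {-1, 1})"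
  have fin: "finite P" unfolding P_def by (intro finite_PiE) auto
  \<comment> \<open>The indicator of a pattern, written as a function of the design so that its
    product with \<open>H\<close> is independent of the errors.\<close>
  define I :: "(nat \<Rightarrow> real) \<Rightarrow> (nat \<Rightarrow> real) \<times> (nat \<times> nat \<Rightarrow> real) \<Rightarrow> real"
    where "I d z = (\<Prod>i<n. indicator {d i} (regressor_of 0 i z))" for d z
  have I_meas [measurable]: "I d \<in> design_space n \<rightarrow>\<^sub>M borel" for d
  proof -
    have "(\<lambda>z. indicator {d i} (regressor_of 0 i z) :: real) \<in> design_space n \<rightarrow>\<^sub>M borel" if "i < n" for i
      by (rule measurable_compose[OF regressor_of_measurable[OF that]]) (auto intro!: borel_measurable_indicator)
    then show ?thesis unfolding I_def[abs_def] by (intro borel_measurable_prod) auto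
  qed
  note [measurable] = H(1) design_measurable
  have I_design: "I d (design n \<omega>) = (if \<forall>i<n. 2 * T n i \<omega> - 1 = d i then 1 else 0)" for d \<omega>
  proof -
    have "I d (design n \<omega>) = (\<Prod>i<n. if 2 * T n i \<omega> - 1 = d i then 1 else 0)"
      unfolding I_def by (intro prod.cong refl) (simp add: regressor_of_def indicator_def)
    then show ?thesis by (auto simp: prod_zero_iff)
  qed
  \<comment> \<open>Exactly one pattern is realized. The function \<open>g\<close> is arbitrary, so
    it may be the error exponential at a fixed outcome as well as the constant 1.\<close>
  have partition: "(\<Sum>d\<in>P. I d (design n \<omega>) * g d) = g (\<lambda>i\<in>{..<n}. 2 * T n i \<omega> - 1)"
    if "\<omega> \<in> space M" for \<omega> and g :: "(nat \<Rightarrow> real) \<Rightarrow> complex"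
  proof -
    let ?d = "\<lambda>i\<in>{..<n}. 2 * T n i \<omega> - 1"
    have "?d \<in> P" unfolding P_def using assignment_01[OF _ that, of _ n] by (force simp: PiE_def Pi_def)
    have "I d (design n \<omega>) = (if d = ?d then 1 else 0)" if "d \<in> P" for d
      using that unfolding I_design P_def by (auto simp: PiE_def extensional_def fun_eq_iff)
    then have "(\<Sum>d\<in>P. I d (design n \<omega>) * g d) = (\<Sum>d\<in>P. if d = ?d then g d else 0)"
      by (intro sum.cong) auto
    then show ?thesis using fin \<open>?d \<in> P\<close> by (simp add: sum.delta)
  qed
  define A where "A d = (CLINT \<omega>|M. H (design n \<omega>) * I d (design n \<omega>))" for d
  have I_bound: "\<bar>I d z\<bar> \<le> 1" for d z
    unfolding I_def by (auto simp: abs_prod indicator_def intro!: prod_le_1)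
  have HI: "integrable M (\<lambda>\<omega>. H (design n \<omega>) * I d (design n \<omega>))" for d
    using mult_mono[OF H(2) I_bound[of d]]
    by (intro integrable_const_bound[of _ 1]) (auto simp: norm_mult)
  define E where "E d \<omega> = iexp (\<Sum>i<n. s * d i / sqrt (real n) * \<epsilon> i \<omega>)" for d \<omega>
  have int_E: "integrable M (E d)" for d
    unfolding E_def by (rule integrable_iexp) simp_all
  have char_E: "(CLINT \<omega>|M. E d \<omega>) = (\<Prod>i<n. ?\<phi> (s * d i / sqrt (real n)))" for d
    unfolding E_def by (rule char_signed_errors)
  have ind: "indep_var borel (\<lambda>\<omega>. H (design n \<omega>) * I d (design n \<omega>)) borel (E d)" for d
  proof -
    have [measurable]: "(\<lambda>e. e i) \<in> borel_vec {..<n} \<rightarrow>\<^sub>M borel" if "i < n" for i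
      using that by (auto intro!: measurable_component_singleton)
    have "(\<lambda>z. H z * I d z) \<in> design_space n \<rightarrow>\<^sub>M borel" by measurable
    moreover have "(\<lambda>e. iexp (\<Sum>i<n. s * d i / sqrt (real n) * e i)) \<in> borel_vec {..<n} \<rightarrow>\<^sub>M borel" by measurable
    ultimately have "indep_var borel (\<lambda>\<omega>. H (design n \<omega>) * I d (design n \<omega>)) borel
        (\<lambda>\<omega>. iexp (\<Sum>i<n. s * d i / sqrt (real n) * rvec {..<n} \<epsilon> \<omega> i))"
      by (rule indep_design_errors)
    moreover have "(\<Sum>i<n. s * d i / sqrt (real n) * rvec {..<n} \<epsilon> \<omega> i) = (\<Sum>i<n. s * d i / sqrt (real n) * \<epsilon> i \<omega>)" for \<omega>
      by (intro sum.cong) auto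
    ultimately show ?thesis by (simp only: E_def[abs_def])
  qed
  have "(CLINT \<omega>|M. H (design n \<omega>) * iexp (\<Sum>i<n. s * (2 * T n i \<omega> - 1) / sqrt (real n) * \<epsilon> i \<omega>))
      = (CLINT \<omega>|M. \<Sum>d\<in>P. H (design n \<omega>) * I d (design n \<omega>) * E d \<omega>)"
  proof (rule Bochner_Integration.integral_cong[OF refl])
    fix \<omega> assume \<omega>: "\<omega> \<in> space M"
    have "(\<Sum>d\<in>P. H (design n \<omega>) * I d (design n \<omega>) * E d \<omega>) = H (design n \<omega>) * (\<Sum>d\<in>P. I d (design n \<omega>) * E d \<omega>)"
      by (simp add: sum_distrib_left mult.assoc)
    also have "\<dots> = H (design n \<omega>) * E (\<lambda>i\<in>{..<n}. 2 * T n i \<omega> - 1) \<omega>"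
      by (simp only: partition[OF \<omega>])
    also have "E (\<lambda>i\<in>{..<n}. 2 * T n i \<omega> - 1) \<omega> = iexp (\<Sum>i<n. s * (2 * T n i \<omega> - 1) / sqrt (real n) * \<epsilon> i \<omega>)"
      unfolding E_def by (intro arg_cong[where f="\<lambda>y. iexp y"] sum.cong) auto
    finally show "H (design n \<omega>) * iexp (\<Sum>i<n. s * (2 * T n i \<omega> - 1) / sqrt (real n) * \<epsilon> i \<omega>) =
        (\<Sum>d\<in>P. H (design n \<omega>) * I d (design n \<omega>) * E d \<omega>)" by (rule sym)
  qed
  also have "\<dots> = (\<Sum>d\<in>P. CLINT \<omega>|M. H (design n \<omega>) * I d (design n \<omega>) * E d \<omega>)"
    by (intro Bochner_Integration.integral_sum indep_var_integrable[OF ind HI int_E])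
  also have "\<dots> = (\<Sum>d\<in>P. A d * (\<Prod>i<n. ?\<phi> (s * d i / sqrt (real n))))"
    unfolding A_def by (intro sum.cong refl) (simp only: indep_var_lebesgue_integral[OF ind HI int_E] char_E)
  finally have lhs: "(CLINT \<omega>|M. H (design n \<omega>) * iexp (\<Sum>i<n. s * (2 * T n i \<omega> - 1) / sqrt (real n) * \<epsilon> i \<omega>))
    = (\<Sum>d\<in>P. A d * (\<Prod>i<n. ?\<phi> (s * d i / sqrt (real n))))" .
  have "(CLINT \<omega>|M. H (design n \<omega>)) = (CLINT \<omega>|M. \<Sum>d\<in>P. H (design n \<omega>) * I d (design n \<omega>))"
  proof (rule Bochner_Integration.integral_cong[OF refl])
    fix \<omega> assume \<omega>: "\<omega> \<in> space M"
    show "H (design n \<omega>) = (\<Sum>d\<in>P. H (design n \<omega>) * I d (design n \<omega>))"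
      using partition[OF \<omega>, of "\<lambda>_. 1"] by (simp flip: sum_distrib_left)
  qed
  also have "\<dots> = (\<Sum>d\<in>P. A d)"
    unfolding A_def by (intro Bochner_Integration.integral_sum HI)
  finally have rhs: "(CLINT \<omega>|M. H (design n \<omega>)) * w ^ n = (\<Sum>d\<in>P. A d * w ^ n)"
    by (simp add: sum_distrib_right)
  \<comment> \<open>Each pattern is weighted by its probability; as these weights sum to 1, the
    final bound does not grow with the number of patterns.\<close>
  have A: "cmod (A d) \<le> expectation (\<lambda>\<omega>. I d (design n \<omega>))" for d
  proof -
    have "cmod (A d) \<le> expectation (\<lambda>\<omega>. cmod (H (design n \<omega>) * I d (design n \<omega>)))"
      unfolding A_def by (rule integral_norm_bound)
    also have "\<dots> \<le> expectation (\<lambda>\<omega>. I d (design n \<omega>))"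
    proof (rule integral_mono)
      show "integrable M (\<lambda>\<omega>. cmod (H (design n \<omega>) * I d (design n \<omega>)))"
        by (intro integrable_norm HI)
      show "integrable M (\<lambda>\<omega>. I d (design n \<omega>))"
        using I_bound by (intro integrable_const_bound[of _ 1]) auto
      show "cmod (H (design n \<omega>) * I d (design n \<omega>)) \<le> I d (design n \<omega>)" for \<omega>
        using H(2)[of "design n \<omega>"] by (simp add: I_design norm_mult)
    qed
    finally show ?thesis .
  qed
  have "(\<Sum>d\<in>P. expectation (\<lambda>\<omega>. I d (design n \<omega>))) = expectation (\<lambda>\<omega>. \<Sum>d\<in>P. I d (design n \<omega>))"
    using I_bound by (intro Bochner_Integration.integral_sum[symmetric] integrable_const_bound[of _ 1]) auto
  also have "\<dots> = expectation (\<lambda>\<omega>. 1)"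
  proof (rule Bochner_Integration.integral_cong[OF refl])
    fix \<omega> assume "\<omega> \<in> space M"
    from partition[OF this, of "\<lambda>_. 1"] show "(\<Sum>d\<in>P. I d (design n \<omega>)) = 1"
      by (simp flip: of_real_sum)
  qed
  finally have mass: "(\<Sum>d\<in>P. expectation (\<lambda>\<omega>. I d (design n \<omega>))) = 1" by (simp add: prob_space)
  have diff: "cmod ((\<Prod>i<n. ?\<phi> (s * d i / sqrt (real n))) - w ^ n) \<le> real n * \<delta>" if "d \<in> P" for d
  proof -
    \<comment> \<open>Products of numbers in the closed unit disc differ by at most the sum of the
      differences of their factors.\<close>
    have "cmod ((\<Prod>i<n. ?\<phi> (s * d i / sqrt (real n))) - (\<Prod>i<n. w))
        \<le> (\<Sum>i<n. cmod (?\<phi> (s * d i / sqrt (real n)) - w))"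
      using w law.cmod_char_le_1 by (intro norm_prod_diff) auto
    also have "\<dots> \<le> (\<Sum>i<n. \<delta>)"
    proof (intro sum_mono close)
      fix i assume "i \<in> {..<n}"
      then show "\<bar>d i\<bar> = 1" using that by (auto simp: P_def PiE_def Pi_def)
    qed
    finally show ?thesis by simp
  qed
  have "cmod ((\<Sum>d\<in>P. A d * (\<Prod>i<n. ?\<phi> (s * d i / sqrt (real n)))) - (\<Sum>d\<in>P. A d * w ^ n))
      \<le> (\<Sum>d\<in>P. cmod (A d * ((\<Prod>i<n. ?\<phi> (s * d i / sqrt (real n))) - w ^ n)))"
    by (simp only: sum_subtractf[symmetric] right_diff_distrib[symmetric] norm_sum)
  also have "\<dots> \<le> (\<Sum>d\<in>P. expectation (\<lambda>\<omega>. I d (design n \<omega>)) * (real n * \<delta>))"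
    unfolding norm_mult
    by (intro sum_mono mult_mono A diff order_trans[OF norm_ge_zero A] norm_ge_zero)
  also have "\<dots> = real n * \<delta>" by (simp only: sum_distrib_right[symmetric] mass mult_1)
  finally show ?thesis by (simp only: lhs rhs)
qed

text \<open>With \<open>w\<close> equal to 1 minus
  \<open>s\<^sup>2 * \<sigma>\<^sup>2 / 2 / real n\<close>, the error of replacing the
  \<open>n\<close> factors is at most \<open>\<rho> n\<close>, and the power of \<open>w\<close>
  tends to the Gaussian factor. The limit is a product, which is the asymptotic independence of the
  two parts.\<close>

lemma char_design_errors_tendsto:
  fixes H :: "nat \<Rightarrow> (nat \<Rightarrow> real) \<times> (nat \<times> nat \<Rightarrow> real) \<Rightarrow> complex"
  assumes H: "\<And>n. H n \<in> design_space n \<rightarrow>\<^sub>M borel" "\<And>n z. cmod (H n z) \<le> 1"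
    and lim: "(\<lambda>n. CLINT \<omega>|M. H n (design n \<omega>)) \<longlonglongrightarrow> L"
  shows "(\<lambda>n. CLINT \<omega>|M. H n (design n \<omega>) * iexp (\<Sum>i<n. s * (2 * T n i \<omega> - 1) / sqrt (real n) * \<epsilon> i \<omega>))
    \<longlonglongrightarrow> L * of_real (exp (- (s\<^sup>2 * \<sigma>\<^sup>2 / 2)))"
proof -
  obtain \<rho> :: "nat \<Rightarrow> real" where \<rho>: "\<rho> \<longlonglongrightarrow> 0"
    "\<And>n a. n > 0 \<Longrightarrow> \<bar>a\<bar> = 1 \<Longrightarrow> cmod (char (distr M borel (\<epsilon> 0)) (s * a / sqrt (real n)) -
      of_real (1 - s\<^sup>2 * \<sigma>\<^sup>2 / 2 / real n)) \<le> \<rho> n / real n"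
    using char_scaled_error[OF error_measurable \<epsilon>_integrable \<epsilon>_sq_integrable \<epsilon>_mean \<epsilon>_var] by metis
  let ?w = "\<lambda>n. 1 - s\<^sup>2 * \<sigma>\<^sup>2 / 2 / real n"
  let ?C = "\<lambda>n. CLINT \<omega>|M. H n (design n \<omega>) * iexp (\<Sum>i<n. s * (2 * T n i \<omega> - 1) / sqrt (real n) * \<epsilon> i \<omega>)"
  let ?D = "\<lambda>n. (CLINT \<omega>|M. H n (design n \<omega>)) * of_real (?w n) ^ n"
  have ev: "\<forall>\<^sub>F n in sequentially. cmod (?C n - ?D n) \<le> \<rho> n"
    \<comment> \<open>For such \<open>n\<close> the real number \<open>?w n\<close> lies in [-1, 1],
      as the comparison of products requires.\<close>
    using eventually_gt_at_top[of "max 1 (nat \<lceil>s\<^sup>2 * \<sigma>\<^sup>2\<rceil>)"]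
  proof eventually_elim
    case (elim n)
    then have n: "n > 0" "s\<^sup>2 * \<sigma>\<^sup>2 \<le> real n"
      using real_nat_ceiling_ge[of "s\<^sup>2 * \<sigma>\<^sup>2"] by linarith+
    then have "\<bar>?w n\<bar> \<le> 1" by (auto simp: abs_if field_simps)
    then have "cmod (of_real (?w n)) \<le> 1" by (simp only: norm_of_real)
    from char_design_errors[OF H this \<rho>(2)[OF n(1)]] n(1) show ?case by simp
  qed
  have "(\<lambda>n. complex_of_real ((1 + (- (s\<^sup>2 * \<sigma>\<^sup>2 / 2)) / real n) ^ n)) \<longlonglongrightarrow> of_real (exp (- (s\<^sup>2 * \<sigma>\<^sup>2 / 2)))"
    by (intro tendsto_of_real tendsto_exp_limit_sequentially)
  then have "?D \<longlonglongrightarrow> L * of_real (exp (- (s\<^sup>2 * \<sigma>\<^sup>2 / 2)))"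
    by (intro tendsto_mult lim) simp
  then show ?thesis
    by (rule Lim_transform) (rule Lim_null_comparison[OF ev \<rho>(1)])
qed

text \<open>The exponential of the score splits into \<open>H\<close>, a function of the design that
  carries the omitted covariates, and the signed errors at frequency \<open>s = 2 * t\<close>. The
  first factor converges by \<open>conv\<close>, and the signed errors contribute the Gaussian
  factor.\<close>

lemma char_treatment_score_tendsto:
  assumes N: "prob_space N"
    and \<xi>: "\<And>j. j < p + q \<Longrightarrow> \<xi> j \<in> borel_measurable N"
    and conv: "weak_conv_vec {..<p+q}
      (\<lambda>n. distr M (borel_vec {..<p+q})
        (rvec {..<p+q} (\<lambda>j \<omega>. (\<Sum>i<n. (2 * T n i \<omega> - 1) * x i j \<omega>) / sqrt (real n))))
      (distr N (borel_vec {..<p+q}) (rvec {..<p+q} \<xi>))"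
  shows "(\<lambda>n. char (distr M borel (\<lambda>\<omega>. 2 * score \<beta> 0 n \<omega>)) t) \<longlonglongrightarrow>
    (CLINT \<omega>|N. iexp (\<Sum>j\<in>{p..<p+q}. 2 * t * \<beta> j * \<xi> j \<omega>)) * of_real (exp (- ((2 * t)\<^sup>2 * \<sigma>\<^sup>2 / 2)))"
proof -
  let ?V = "\<lambda>n j \<omega>. (\<Sum>i<n. (2 * T n i \<omega> - 1) * x i j \<omega>) / sqrt (real n)"
  have V: "?V n j \<in> borel_measurable M" if "j < p + q" for n j
    using that assignment_measurable covariate_measurable
    by (intro borel_measurable_divide borel_measurable_sum borel_measurable_times borel_measurable_diff) auto
  define H where "H n z = iexp (\<Sum>j\<in>{p..<p+q}. 2 * t * \<beta> j *
      ((\<Sum>i<n. regressor_of 0 i z * regressor_of (Suc (Suc j)) i z) / sqrt (real n)))" for n z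
  have H: "H n \<in> design_space n \<rightarrow>\<^sub>M borel" for n
  proof -
    have "(\<lambda>z. \<Sum>j\<in>{p..<p+q}. 2 * t * \<beta> j *
      ((\<Sum>i<n. regressor_of 0 i z * regressor_of (Suc (Suc j)) i z) / sqrt (real n))) \<in> design_space n \<rightarrow>\<^sub>M borel"
      by (intro borel_measurable_sum borel_measurable_times borel_measurable_divide borel_measurable_const
          regressor_of_measurable) auto
    then show ?thesis unfolding H_def[abs_def] by measurable
  qed
  have reg: "regressor_of 0 i (design n \<omega>) * regressor_of (Suc (Suc j)) i (design n \<omega>) = (2 * T n i \<omega> - 1) * x i j \<omega>"
    if "i < n" "j < p + q" for i j n \<omega>
    unfolding regressor_of_def using that by simp
  have H_design: "H n (design n \<omega>) = iexp (\<Sum>j\<in>{p..<p+q}. 2 * t * \<beta> j * ?V n j \<omega>)" for n \<omega>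
  proof -
    have "(\<Sum>i<n. regressor_of 0 i (design n \<omega>) * regressor_of (Suc (Suc j)) i (design n \<omega>)) =
        (\<Sum>i<n. (2 * T n i \<omega> - 1) * x i j \<omega>)" if "j \<in> {p..<p+q}" for j
      using that by (intro sum.cong refl reg) auto
    then show ?thesis
      unfolding H_def by (intro arg_cong[where f="\<lambda>y. iexp y"] sum.cong refl) (simp only:)
  qed
  have "(\<lambda>n. CLINT \<omega>|M. H n (design n \<omega>)) \<longlonglongrightarrow> (CLINT \<omega>|N. iexp (\<Sum>j\<in>{p..<p+q}. 2 * t * \<beta> j * \<xi> j \<omega>))"
    unfolding H_design by (rule weak_conv_vec_char[OF conv N]) (use V \<xi> in auto)
  from char_design_errors_tendsto[OF H _ this, of "2 * t"]
  have lim: "(\<lambda>n. CLINT \<omega>|M. H n (design n \<omega>) * iexp (\<Sum>i<n. 2 * t * (2 * T n i \<omega> - 1) / sqrt (real n) * \<epsilon> i \<omega>))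
    \<longlonglongrightarrow> (CLINT \<omega>|N. iexp (\<Sum>j\<in>{p..<p+q}. 2 * t * \<beta> j * \<xi> j \<omega>)) * of_real (exp (- ((2 * t)\<^sup>2 * \<sigma>\<^sup>2 / 2)))"
    by (simp add: H_def del: of_real_sum of_real_mult of_real_divide)
  have score_measurable: "(\<lambda>\<omega>. 2 * score \<beta> 0 n \<omega>) \<in> borel_measurable M" for n
    unfolding score_eq using V assignment_measurable
    by (intro borel_measurable_times borel_measurable_add borel_measurable_sum borel_measurable_divide)
       (auto intro!: borel_measurable_times borel_measurable_diff borel_measurable_sum covariate_measurable)
  have "iexp (t * (2 * score \<beta> 0 n \<omega>)) =
      H n (design n \<omega>) * iexp (\<Sum>i<n. 2 * t * (2 * T n i \<omega> - 1) / sqrt (real n) * \<epsilon> i \<omega>)" for n \<omega>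
  proof -
    have "t * (2 * score \<beta> 0 n \<omega>) = (\<Sum>j\<in>{p..<p+q}. 2 * t * \<beta> j * ?V n j \<omega>) +
        2 * t * ((\<Sum>i<n. (2 * T n i \<omega> - 1) * \<epsilon> i \<omega>) / sqrt (real n))"
      unfolding score_eq regressor_simps by (simp only: distrib_left sum_distrib_left mult_ac)
    also have "2 * t * ((\<Sum>i<n. (2 * T n i \<omega> - 1) * \<epsilon> i \<omega>) / sqrt (real n)) =
        (\<Sum>i<n. 2 * t * (2 * T n i \<omega> - 1) / sqrt (real n) * \<epsilon> i \<omega>)"
      by (simp only: sum_distrib_left sum_divide_distrib times_divide_eq_left times_divide_eq_right mult_ac)
    finally show ?thesis unfolding H_design by (simp only: of_real_add distrib_left exp_add)
  qed
  then have "char (distr M borel (\<lambda>\<omega>. 2 * score \<beta> 0 n \<omega>)) t =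
      (CLINT \<omega>|M. H n (design n \<omega>) * iexp (\<Sum>i<n. 2 * t * (2 * T n i \<omega> - 1) / sqrt (real n) * \<epsilon> i \<omega>))" for n
    unfolding char_def by (subst integral_distr[OF score_measurable]) (simp_all del: of_real_mult of_real_sum)
  with lim show ?thesis by (simp only:)
qed

section \<open>Reduction of the least squares contrast to the treatment score\<close>

text \<open>Off an event of vanishing probability the deterministic expansion bounds the remainder
  by a vanishing off-diagonal sum times a sum of scores that is bounded in probability.\<close>

lemma ols_contrast_remainder_null:
  assumes balance: "\<And>j. j < p + q \<Longrightarrow> bounded_in_prob (\<lambda>n \<omega>. (\<Sum>i<n. (2 * T n i \<omega> - 1) * x i j \<omega>) / sqrt (real n))"
    and global: "tendsto_in_prob M (\<lambda>n \<omega>. (\<Sum>i<n. 2 * T n i \<omega> - 1) / real n) 0"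
    and ols: "\<And>n \<omega>. \<omega> \<in> space M \<Longrightarrow>
      is_ols (design_matrix p T x n \<omega>) (outcome (p + q) \<mu>\<^sub>1 \<mu>\<^sub>2 \<beta> T x \<epsilon> n \<omega>) (\<theta>hat n \<omega>)"
    and ols_measurable: "\<And>n k. k < p + 2 \<Longrightarrow> (\<lambda>\<omega>. \<theta>hat n \<omega> $ k) \<in> borel_measurable M"
  shows "null_in_prob (\<lambda>n \<omega>. sqrt (real n) * ((\<theta>hat n \<omega> $ 0 - \<theta>hat n \<omega> $ 1) - (\<mu>\<^sub>1 - \<mu>\<^sub>2)) - 2 * score \<beta> 0 n \<omega>)"
proof -
  let ?P = "\<lambda>k h. h > 0 \<and> (\<lambda>n. prob {\<omega>\<in>space M. n > 0 \<and> gram n \<omega> k k < h}) \<longlonglongrightarrow> 0"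
  have "\<exists>h. ?P k h" if "k < p + q + 2" for k
    by (rule gram_diag_bounded_below[OF that]) blast
  then have "\<forall>k\<in>{..<p + q + 2}. \<exists>h. ?P k h" by blast
  from bchoice[OF this] obtain h where h': "\<forall>k\<in>{..<p + q + 2}. ?P k (h k)" by blast
  have h: "h k > 0" "(\<lambda>n. prob {\<omega>\<in>space M. n > 0 \<and> gram n \<omega> k k < h k}) \<longlonglongrightarrow> 0"
    if "k < p + 2" for k
    using h' that by auto
  \<comment> \<open>One lower bound for all diagonal entries; the index set is finite and nonempty,
    so the minimum is positive.\<close>
  define h0 where "h0 = Min (h ` {..<p + 2})"
  have "h ` {..<p + 2} \<noteq> {}" by auto
  then have h0: "h0 > 0" "\<And>k. k < p + 2 \<Longrightarrow> h0 \<le> h k"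
    unfolding h0_def using h(1) by (simp_all del: lessThan_Suc add: Min_gr_iff)
  have off_null: "null_in_prob (\<lambda>n \<omega>. offdiag (p + 2) (gram n \<omega>))"
    unfolding offdiag_def
    by (intro null_in_prob_sum null_in_prob_abs gram_offdiag_null balance global) auto
  note [measurable] = null_in_prob_measurable[OF off_null]
  have score_meas: "score \<beta> k n \<in> borel_measurable M" if "k < p + 2" for k n
    using score_bounded[OF balance that] by (rule bounded_in_prob_measurable)
  have V: "null_in_prob (\<lambda>n \<omega>. offdiag (p + 2) (gram n \<omega>) * (4 / h0 * (\<Sum>k<p + 2. \<bar>score \<beta> k n \<omega>\<bar>)))"
    by (intro null_times_bounded_in_prob off_null bounded_in_prob_cmult bounded_in_prob_sum
        bounded_in_prob_abs score_bounded balance) auto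
  \<comment> \<open>\<open>B\<close> and \<open>C\<close> are the two ways in which diagonal
    dominance with constant \<open>h0\<close> can fail: a small diagonal entry or a large
    off-diagonal sum.\<close>
  define B where "B n k = {\<omega>\<in>space M. n > 0 \<and> gram n \<omega> k k < h k}" for n :: nat and k
  define C where "C n = {\<omega>\<in>space M. \<bar>offdiag (p + 2) (gram n \<omega>)\<bar> > h0 / 2}" for n
  have B: "B n k \<in> events" if "k < p + 2" for n k
  proof -
    have [measurable]: "(\<lambda>\<omega>. gram n \<omega> k k) \<in> borel_measurable M" using that by (intro gram_measurable) auto
    show ?thesis unfolding B_def by measurable
  qed
  have C: "C n \<in> events" for n unfolding C_def by measurable
  show ?thesis
  proof (rule null_in_prob_dominated[OF _ V])
    show "(\<lambda>\<omega>. sqrt (real n) * ((\<theta>hat n \<omega> $ 0 - \<theta>hat n \<omega> $ 1) - (\<mu>\<^sub>1 - \<mu>\<^sub>2)) - 2 * score \<beta> 0 n \<omega>) \<in> borel_measurable M" for n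
      using ols_measurable[of 0 n] ols_measurable[of 1 n] score_meas[of 0 n] by measurable
    show "C n \<union> (\<Union>k<p + 2. B n k) \<in> events" for n
      using B C by auto
    have lim: "(\<lambda>n. prob (C n) + (\<Sum>k<p + 2. prob (B n k))) \<longlonglongrightarrow> 0"
      using h(2) h0(1) unfolding B_def C_def
      by (intro tendsto_add_zero tendsto_null_sum null_in_probD[OF off_null]) auto
    have le: "prob (C n \<union> (\<Union>k<p + 2. B n k)) \<le> prob (C n) + (\<Sum>k<p + 2. prob (B n k))" for n
    proof -
      have "prob (C n \<union> (\<Union>k<p + 2. B n k)) \<le> prob (C n) + prob (\<Union>k<p + 2. B n k)"
        using B C by (intro measure_Un_le) auto
      also have "prob (\<Union>k<p + 2. B n k) \<le> (\<Sum>k<p + 2. prob (B n k))"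
        using B by (intro finite_measure_subadditive_finite) auto
      finally show ?thesis by simp
    qed
    show "(\<lambda>n. prob (C n \<union> (\<Union>k<p + 2. B n k))) \<longlonglongrightarrow> 0"
      by (rule tendsto_sandwich[OF always_eventually always_eventually tendsto_const lim]) (use le in auto)
  next
    fix n :: nat and \<omega> assume n: "n > 0" and \<omega>: "\<omega> \<in> space M - (C n \<union> (\<Union>k<p + 2. B n k))"
    have diag: "h0 \<le> gram n \<omega> k k" if "k < p + 2" for k
      using \<omega> n that h0(2)[OF that] by (force simp: B_def)
    have off: "offdiag (p + 2) (gram n \<omega>) \<le> h0 / 2"
      using \<omega> offdiag_nonneg[of "p + 2" "gram n \<omega>"] by (auto simp: C_def)
    \<comment> \<open>Splitting the true model at \<open>p\<close> turns the omitted covariates and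
      the error into the noise \<open>r\<close> of the deterministic expansion.\<close>
    have "(\<Sum>j<p + q. \<beta> j * x i j \<omega>) = (\<Sum>j<p. \<beta> j * x i j \<omega>) + (\<Sum>j\<in>{p..<p+q}. \<beta> j * x i j \<omega>)" for i
      unfolding lessThan_atLeast0 by (rule sum.atLeastLessThan_concat[symmetric]) auto
    then have Y: "outcome (p + q) \<mu>\<^sub>1 \<mu>\<^sub>2 \<beta> T x \<epsilon> n \<omega> = vec n (\<lambda>i. \<mu>\<^sub>1 * T n i \<omega> + \<mu>\<^sub>2 * (1 - T n i \<omega>) +
        (\<Sum>k<p. \<beta> k * x i k \<omega>) + omitted \<beta> i \<omega>)"
      by (auto simp: outcome_def omitted_def)
    have reg: "(if k = 0 then 2 * T n i \<omega> - 1 else if k = 1 then 1 else x i (k - 2) \<omega>) = regressor n k i \<omega>" for k i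
      by (simp add: regressor_def)
    have G: "mat n (p + 2) (\<lambda>(i, k). if k = 0 then T n i \<omega> else if k = 1 then 1 - T n i \<omega> else x i (k - 2) \<omega>) =
        design_matrix p T x n \<omega>"
      by (simp add: design_matrix_def)
    have "\<bar>sqrt (real n) * ((\<theta>hat n \<omega> $ 0 - \<theta>hat n \<omega> $ 1) - (\<mu>\<^sub>1 - \<mu>\<^sub>2)) - 2 * score \<beta> 0 n \<omega>\<bar>
      \<le> 4 / h0 * (offdiag (p + 2) (gram n \<omega>) * (\<Sum>k<p + 2. \<bar>score \<beta> k n \<omega>\<bar>))"
    proof (rule ols_contrast_expansion[where t="\<lambda>i. T n i \<omega>" and z="\<lambda>i k. x i k \<omega>" and r="\<lambda>i. omitted \<beta> i \<omega>"
          and \<theta>="\<theta>hat n \<omega>" and h=h0 and n=n and p=p and \<mu>\<^sub>1=\<mu>\<^sub>1 and \<mu>\<^sub>2=\<mu>\<^sub>2 and \<beta>=\<beta>,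
          unfolded reg G Y[symmetric], folded gram_def score_def])
      show "T n i \<omega> \<in> {0, 1}" if "i < n" for i using assignment_01[OF that] \<omega> by blast
      show "is_ols (design_matrix p T x n \<omega>) (outcome (p + q) \<mu>\<^sub>1 \<mu>\<^sub>2 \<beta> T x \<epsilon> n \<omega>) (\<theta>hat n \<omega>)"
        using ols \<omega> by blast
    qed (fact n h0(1) diag off)+
    also have "\<dots> \<le> \<bar>offdiag (p + 2) (gram n \<omega>) * (4 / h0 * (\<Sum>k<p + 2. \<bar>score \<beta> k n \<omega>\<bar>))\<bar>"
      by (rule order_trans[OF _ abs_ge_self]) (simp add: mult_ac del: sum.lessThan_Suc)
    finally show "\<bar>sqrt (real n) * ((\<theta>hat n \<omega> $ 0 - \<theta>hat n \<omega> $ 1) - (\<mu>\<^sub>1 - \<mu>\<^sub>2)) - 2 * score \<beta> 0 n \<omega>\<bar>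
      \<le> \<bar>offdiag (p + 2) (gram n \<omega>) * (4 / h0 * (\<Sum>k<p + 2. \<bar>score \<beta> k n \<omega>\<bar>))\<bar>" .
  qed
qed

end

section \<open>Limit law of the estimated treatment contrast\<close>

theorem corollary3p2:
  fixes M :: "'a measure" and N :: "'b measure"
    and p q :: nat
    and T :: "nat \<Rightarrow> nat \<Rightarrow> 'a \<Rightarrow> real"
    and X :: "nat \<Rightarrow> 'a \<Rightarrow> real"
    and x :: "nat \<Rightarrow> nat \<Rightarrow> 'a \<Rightarrow> real"
    and \<epsilon> :: "nat \<Rightarrow> 'a \<Rightarrow> real"
    and \<sigma> \<mu>\<^sub>1 \<mu>\<^sub>2 :: real and \<beta> :: "nat \<Rightarrow> real"
    and \<theta>hat :: "nat \<Rightarrow> 'a \<Rightarrow> real vec"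
    and \<xi> :: "nat \<Rightarrow> 'b \<Rightarrow> real" and Z :: "'b \<Rightarrow> real"
  assumes setting: "car_setting M p q T X x \<epsilon> \<sigma>"
    and ols: "\<And>n \<omega>. \<omega> \<in> space M \<Longrightarrow>
      is_ols (design_matrix p T x n \<omega>) (outcome (p + q) \<mu>\<^sub>1 \<mu>\<^sub>2 \<beta> T x \<epsilon> n \<omega>) (\<theta>hat n \<omega>)"
    and ols_measurable: "\<And>n k. k < p + 2 \<Longrightarrow> (\<lambda>\<omega>. \<theta>hat n \<omega> $ k) \<in> borel_measurable M"
    and A1: "tendsto_in_prob M (\<lambda>n \<omega>. (\<Sum>i<n. 2 * T n i \<omega> - 1) / real n) 0"
    and N: "prob_space N"
    and xi_measurable: "\<And>j. j < p + q \<Longrightarrow> \<xi> j \<in> borel_measurable N"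
    and A2: "weak_conv_vec {..<p+q}
      (\<lambda>n. distr M (borel_vec {..<p+q})
        (rvec {..<p+q} (\<lambda>j \<omega>. (\<Sum>i<n. (2 * T n i \<omega> - 1) * x i j \<omega>) / sqrt (real n))))
      (distr N (borel_vec {..<p+q}) (rvec {..<p+q} \<xi>))"
    and xi_integrable: "\<And>j. j < p + q \<Longrightarrow> integrable N (\<xi> j)"
    and xi_mean: "\<And>j. j < p + q \<Longrightarrow> prob_space.expectation N (\<xi> j) = 0"
    and Z_normal: "distributed N lborel Z std_normal_density"
    and Z_indep: "prob_space.indep_rv N borel Z (borel_vec {p..<p+q}) (rvec {p..<p+q} \<xi>)"
  shows "weak_conv_m
    (\<lambda>n. distr M borel (\<lambda>\<omega>. sqrt (real n) * ((\<theta>hat n \<omega> $ 0 - \<theta>hat n \<omega> $ 1) - (\<mu>\<^sub>1 - \<mu>\<^sub>2))))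
    (distr N borel (\<lambda>\<omega>. 2 * \<sigma> * Z \<omega> + 2 * (\<Sum>j\<in>{p..<p+q}. \<beta> j * \<xi> j \<omega>)))"
proof -
  interpret car_setting M p q T X x \<epsilon> \<sigma> by (rule setting)
  interpret N: prob_space N by (rule N)
  let ?S = "\<lambda>n \<omega>. sqrt (real n) * ((\<theta>hat n \<omega> $ 0 - \<theta>hat n \<omega> $ 1) - (\<mu>\<^sub>1 - \<mu>\<^sub>2))"
  let ?L = "\<lambda>\<omega>. \<Sum>j\<in>{p..<p+q}. \<beta> j * \<xi> j \<omega>"
  have Z [measurable]: "Z \<in> borel_measurable N"
    using Z_normal by (auto simp: distributed_def)
  have L [measurable]: "?L \<in> borel_measurable N"
    using xi_measurable by (intro borel_measurable_sum borel_measurable_times) auto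
  have V: "(\<lambda>\<omega>. (\<Sum>i<n. (2 * T n i \<omega> - 1) * x i j \<omega>) / sqrt (real n)) \<in> borel_measurable M"
    if "j < p + q" for n j
    using that assignment_measurable covariate_measurable
    by (intro borel_measurable_divide borel_measurable_sum borel_measurable_times borel_measurable_diff) auto
  \<comment> \<open>Weak convergence to an integrable limit gives tightness of every coordinate, the
    form in which covariate balance enters the Gram matrix and the scores.\<close>
  have balance: "bounded_in_prob (\<lambda>n \<omega>. (\<Sum>i<n. (2 * T n i \<omega> - 1) * x i j \<omega>) / sqrt (real n))"
    if "j < p + q" for j
    using that by (intro weak_conv_vec_bounded_in_prob[OF A2 N] V xi_measurable xi_integrable) auto
  have S: "?S n \<in> borel_measurable M" for n
    using ols_measurable[of 0 n] ols_measurable[of 1 n] by measurable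
  have score: "(\<lambda>\<omega>. 2 * score \<beta> 0 n \<omega>) \<in> borel_measurable M" for n
    using bounded_in_prob_measurable[OF score_bounded[OF balance, of 0], of \<beta> n] by simp
  have indep: "N.indep_var borel (\<lambda>\<omega>. 2 * \<sigma> * Z \<omega>) borel (\<lambda>\<omega>. 2 * ?L \<omega>)"
  proof -
    have "(\<lambda>z. z j) \<in> borel_vec {p..<p+q} \<rightarrow>\<^sub>M borel" if "j \<in> {p..<p+q}" for j
      using that by (rule measurable_component_singleton)
    then have "(\<lambda>z. 2 * (\<Sum>j\<in>{p..<p+q}. \<beta> j * z j)) \<in> borel_vec {p..<p+q} \<rightarrow>\<^sub>M borel"
      by (intro borel_measurable_times borel_measurable_sum borel_measurable_const) auto
    moreover have "(\<lambda>z. 2 * \<sigma> * z) \<in> borel \<rightarrow>\<^sub>M (borel :: real measure)" by measurable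
    ultimately have "N.indep_var borel (\<lambda>\<omega>. 2 * \<sigma> * Z \<omega>) borel
        (\<lambda>\<omega>. 2 * (\<Sum>j\<in>{p..<p+q}. \<beta> j * rvec {p..<p+q} \<xi> \<omega> j))"
      by (rule N.indep_rv_compose[OF Z_indep, rotated])
    moreover have "(\<Sum>j\<in>{p..<p+q}. \<beta> j * rvec {p..<p+q} \<xi> \<omega> j) = ?L \<omega>" for \<omega>
      by (intro sum.cong) auto
    ultimately show ?thesis by (simp only:)
  qed
  \<comment> \<open>The Gaussian factor of the score limit is recognized as the characteristic
    function of \<open>2 * \<sigma> * Z\<close>, with variance four times
    \<open>\<sigma>\<^sup>2\<close>.\<close>
  have char_Z: "char (distr N borel (\<lambda>\<omega>. 2 * \<sigma> * Z \<omega>)) t = of_real (exp (- ((2 * t)\<^sup>2 * \<sigma>\<^sup>2 / 2)))" for t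
  proof -
    have "distr N borel Z = std_normal_distribution"
      using distributed_distr_eq_density[OF Z_normal] by (simp cong: distr_cong)
    then have "char (distr N borel Z) (2 * \<sigma> * t) = of_real (exp (- ((2 * \<sigma> * t)\<^sup>2) / 2))"
      by (simp only: char_std_normal_distribution)
    moreover have "char (distr N borel (\<lambda>\<omega>. 2 * \<sigma> * Z \<omega>)) t = char (distr N borel Z) (2 * \<sigma> * t)"
      by (simp add: char_def integral_distr mult_ac)
    ultimately show ?thesis by (simp add: power_mult_distrib mult_ac)
  qed
  have char_L: "char (distr N borel (\<lambda>\<omega>. 2 * ?L \<omega>)) t = (CLINT \<omega>|N. iexp (\<Sum>j\<in>{p..<p+q}. 2 * t * \<beta> j * \<xi> j \<omega>))" for t
  proof -
    have "t * (2 * ?L \<omega>) = (\<Sum>j\<in>{p..<p+q}. 2 * t * \<beta> j * \<xi> j \<omega>)" for \<omega>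
      by (simp add: sum_distrib_left mult_ac)
    moreover have "char (distr N borel (\<lambda>\<omega>. 2 * ?L \<omega>)) t = (CLINT \<omega>|N. iexp (t * (2 * ?L \<omega>)))"
      unfolding char_def by (rule integral_distr) measurable
    ultimately show ?thesis by (simp only:)
  qed
  show ?thesis
  proof (rule levy_continuity)
    show "real_distribution (distr M borel (?S n))" for n
      using S by (rule real_distribution_distr)
    show "real_distribution (distr N borel (\<lambda>\<omega>. 2 * \<sigma> * Z \<omega> + 2 * ?L \<omega>))"
      by (rule N.real_distribution_distr) measurable
    fix t
    \<comment> \<open>Independence of \<open>Z\<close> and the omitted coordinates of
      \<open>\<xi>\<close> makes the characteristic function of the claimed limit the product found
      for the score.\<close>
    have lim: "(\<lambda>n. char (distr M borel (\<lambda>\<omega>. 2 * score \<beta> 0 n \<omega>)) t) \<longlonglongrightarrow>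
        char (distr N borel (\<lambda>\<omega>. 2 * \<sigma> * Z \<omega> + 2 * ?L \<omega>)) t"
      using char_treatment_score_tendsto[OF N xi_measurable A2, of \<beta> t]
      unfolding N.char_distr_add[OF indep] char_Z char_L
      by (subst mult.commute)
    show "(\<lambda>n. char (distr M borel (?S n)) t) \<longlonglongrightarrow>
        char (distr N borel (\<lambda>\<omega>. 2 * \<sigma> * Z \<omega> + 2 * ?L \<omega>)) t"
      by (rule char_tendsto_null_perturbation[OF S score _ lim])
         (rule ols_contrast_remainder_null[OF balance A1 ols ols_measurable])
  qed
qed

end
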